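(* Let $\mathcal C$ be a small balanced braided monoidal category, let $\langle-\rangle:\mathcal C\to\mathcal O$ be a balanced contraction, let $X\in\mathrm{Ob}\,\mathcal C$ and $n\ge1$. Then there is a commutative diagram of groups $$\begin{matrix}B_n&\leftarrow&\tilde B_n&\to&\mathrm{Aut}_{\mathcal C}(X^{\otimes n})\\ \downarrow&&\downarrow&&\downarrow\langle-\rangle\\ B_n/Z_n&\leftarrow&\widetilde{B_n/Z_n}&\to&\mathrm{Aut}_{\mathcal O}(\langle X^{\otimes n}\rangle)\end{matrix}$$ in which the two left vertical and middle vertical maps are the projections, the left horizontal maps are the projections (killing the generators $\delta_i$), and the upper right map is the canonical representation of $\tilde B_n$. In other words, the composite $\tilde B_n\to\mathrm{Aut}_{\mathcal C}(X^{\otimes n})\to\mathrm{Aut}_{\mathcal O}(\langle X^{\otimes n}\rangle)$ factors through $\widetilde{B_n/Z_n}$.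
   Context: A braided monoidal category (b.m.c.) has associativity constraints $a_{XYZ}:(X\otimes Y)\otimes Z\to X\otimes(Y\otimes Z)$ and a braiding $\beta_{XY}:X\otimes Y\to Y\otimes X$ satisfying the usual axioms. A balanced structure is a natural assignment $X\mapsto\theta_X\in\mathrm{Aut}_{\mathcal C}(X)$ (i.e. $\theta_{X'}\phi=\phi\theta_X$ for $\phi:X\to X'$) with $\theta_{X\otimes Y}=(\theta_X\otimes\theta_Y)\beta_{YX}\beta_{XY}$. A balanced contraction on $\mathcal C$ is a functor $\langle-\rangle:\mathcal C\to\mathcal O$ to a category such that: (1) for all $X,Y$, $\langle Y\otimes X\rangle=\langle X\otimes Y\rangle$ $(=:\langle X,Y\rangle)$ and $\langle(\theta_Y\otimes\mathrm{id}_X)\beta_{XY}\rangle=\mathrm{id}_{\langle X,Y\rangle}$; (2) for all $X,Y,Z$, $\langle(X\otimes Y)\otimes Z\rangle=\langle X\otimes(Y\otimes Z)\rangle$ and $\langle a_{XYZ}\rangle$ is the identity of this object. $B_n$ is the braid group with generators $\sigma_1,\dots,\sigma_{n-1}$; $B_n\to S_n$, $\sigma_i\mapsto(i,i+1)$; $z_n:=(\sigma_1\cdots\sigma_{n-1})^n$ and $Z_n$ is the central subgroup generated by $z_n$ (the center of $B_n$ if $n\ge3$). $\tilde B_n:=\mathbb Z^n\rtimes B_n$, where $B_n$ acts on $\mathbb Z^n$ through $S_n$ by permutation; $\delta_i$ is the $i$-th generator of $\mathbb Z^n$ (written multiplicatively). $\widetilde{B_n/Z_n}$ is the quotient of $\tilde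 B_n$ by the central subgroup generated by $(\prod_{i=1}^n\delta_i)z_n$. Fix a parenthesization of $X^{\otimes n}$. The canonical representation $\tilde B_n\to\mathrm{Aut}_{\mathcal C}(X^{\otimes n})$ is given (up to inserting associativity constraints) by $\delta_i\mapsto\mathrm{id}_{X^{\otimes i-1}}\otimes\theta_X\otimes\mathrm{id}_{X^{\otimes n-i}}$, $\sigma_i\mapsto\mathrm{id}_{X^{\otimes i-1}}\otimes\beta_{X,X}\otimes\mathrm{id}_{X^{\otimes n-i-1}}$. *)

theory Defs
  imports "HOL-Algebra.Product_Groups" "HOL-Algebra.Sym_Groups"
begin

section \<open>Small categories\<close>

record ('o, 'm) cat =
  Obj :: "'o set"
  Arr :: "'m set"
  Dom :: "'m \<Rightarrow> 'o"
  Cod :: "'m \<Rightarrow> 'o"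
  Ident :: "'o \<Rightarrow> 'm"
  Comp :: "'m \<Rightarrow> 'm \<Rightarrow> 'm"  (infixr \<open>\<star>\<index>\<close> 65)

definition Hom :: "('o, 'm, 'e) cat_scheme \<Rightarrow> 'o \<Rightarrow> 'o \<Rightarrow> 'm set"
  where "Hom C X Y = {f \<in> Arr C. Dom C f = X \<and> Cod C f = Y}"

locale category =
  fixes C :: "('o, 'm, 'e) cat_scheme" (structure)
  assumes dom_closed: "f \<in> Arr C \<Longrightarrow> Dom C f \<in> Obj C"
    and cod_closed: "f \<in> Arr C \<Longrightarrow> Cod C f \<in> Obj C"
    and id_hom: "X \<in> Obj C \<Longrightarrow> Ident C X \<in> Hom C X X"
    and comp_hom: "\<lbrakk>f \<in> Hom C X Y; g \<in> Hom C Y Z\<rbrakk> \<Longrightarrow> g \<star> f \<in> Hom C X Z"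
    and comp_id_left: "f \<in> Hom C X Y \<Longrightarrow> Ident C Y \<star> f = f"
    and comp_id_right: "f \<in> Hom C X Y \<Longrightarrow> f \<star> Ident C X = f"
    and comp_assoc: "\<lbrakk>f \<in> Hom C W X; g \<in> Hom C X Y; h \<in> Hom C Y Z\<rbrakk>
      \<Longrightarrow> (h \<star> g) \<star> f = h \<star> (g \<star> f)"

definition inverse_arrows :: "('o, 'm, 'e) cat_scheme \<Rightarrow> 'm \<Rightarrow> 'm \<Rightarrow> bool"
  where "inverse_arrows C f g \<longleftrightarrow> f \<in> Arr C \<and> g \<in> Hom C (Cod C f) (Dom C f) \<and>
    g \<star>\<^bsub>C\<^esub> f = Ident C (Dom C f) \<and> f \<star>\<^bsub>C\<^esub> g = Ident C (Cod C f)"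

definition iso_arrow :: "('o, 'm, 'e) cat_scheme \<Rightarrow> 'm \<Rightarrow> bool"
  where "iso_arrow C f \<longleftrightarrow> (\<exists>g. inverse_arrows C f g)"

definition inv_arrow :: "('o, 'm, 'e) cat_scheme \<Rightarrow> 'm \<Rightarrow> 'm"
  where "inv_arrow C f = (THE g. inverse_arrows C f g)"

definition Aut :: "('o, 'm, 'e) cat_scheme \<Rightarrow> 'o \<Rightarrow> 'm monoid"
  where "Aut C X = \<lparr>carrier = {f \<in> Hom C X X. iso_arrow C f}, monoid.mult = Comp C, one = Ident C X\<rparr>"

locale cat_functor = source: category C + target: category D
  for C :: "('o, 'm, 'e) cat_scheme" and D :: "('p, 'n, 'd) cat_scheme" +
  fixes Fo :: "'o \<Rightarrow> 'p" and Fa :: "'m \<Rightarrow> 'n"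
  assumes functor_obj: "X \<in> Obj C \<Longrightarrow> Fo X \<in> Obj D"
    and functor_hom: "f \<in> Hom C X Y \<Longrightarrow> Fa f \<in> Hom D (Fo X) (Fo Y)"
    and functor_id: "X \<in> Obj C \<Longrightarrow> Fa (Ident C X) = Ident D (Fo X)"
    and functor_comp: "\<lbrakk>f \<in> Hom C X Y; g \<in> Hom C Y Z\<rbrakk>
      \<Longrightarrow> Fa (g \<star>\<^bsub>C\<^esub> f) = Fa g \<star>\<^bsub>D\<^esub> Fa f"

section \<open>Braided and balanced monoidal categories\<close>

text \<open>The associator is \<open>a\<^sub>X\<^sub>Y\<^sub>Z : (X \<otimes> Y) \<otimes> Z \<rightarrow> X \<otimes> (Y \<otimes> Z)\<close>.\<close>

record ('o, 'm) monoidal_cat = "('o, 'm) cat" +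
  Tens :: "'o \<Rightarrow> 'o \<Rightarrow> 'o"  (infixl \<open>\<boxtimes>\<index>\<close> 70)
  Tensa :: "'m \<Rightarrow> 'm \<Rightarrow> 'm"  (infixl \<open>\<boxtimes>\<^sub>a\<index>\<close> 70)
  Unit :: "'o"
  Assoc :: "'o \<Rightarrow> 'o \<Rightarrow> 'o \<Rightarrow> 'm"
  LUnit :: "'o \<Rightarrow> 'm"
  RUnit :: "'o \<Rightarrow> 'm"

record ('o, 'm) braided_cat = "('o, 'm) monoidal_cat" +
  Braid :: "'o \<Rightarrow> 'o \<Rightarrow> 'm"

record ('o, 'm) balanced_cat = "('o, 'm) braided_cat" +
  Twist :: "'o \<Rightarrow> 'm"

locale monoidal_category = category C
  for C :: "('o, 'm, 'e) monoidal_cat_scheme" (structure) +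
  assumes tens_obj: "\<lbrakk>X \<in> Obj C; Y \<in> Obj C\<rbrakk> \<Longrightarrow> X \<boxtimes> Y \<in> Obj C"
    and tens_hom: "\<lbrakk>f \<in> Hom C X X'; g \<in> Hom C Y Y'\<rbrakk>
      \<Longrightarrow> f \<boxtimes>\<^sub>a g \<in> Hom C (X \<boxtimes> Y) (X' \<boxtimes> Y')"
    and tens_id: "\<lbrakk>X \<in> Obj C; Y \<in> Obj C\<rbrakk> \<Longrightarrow> Ident C X \<boxtimes>\<^sub>a Ident C Y = Ident C (X \<boxtimes> Y)"
    and tens_comp: "\<lbrakk>f \<in> Hom C X X'; f' \<in> Hom C X' X''; g \<in> Hom C Y Y'; g' \<in> Hom C Y' Y''\<rbrakk>
      \<Longrightarrow> (f' \<star> f) \<boxtimes>\<^sub>a (g' \<star> g) = (f' \<boxtimes>\<^sub>a g') \<star> (f \<boxtimes>\<^sub>a g)"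
    and unit_obj: "Unit C \<in> Obj C"
    and assoc_hom: "\<lbrakk>X \<in> Obj C; Y \<in> Obj C; Z \<in> Obj C\<rbrakk>
      \<Longrightarrow> Assoc C X Y Z \<in> Hom C ((X \<boxtimes> Y) \<boxtimes> Z) (X \<boxtimes> (Y \<boxtimes> Z))"
    and assoc_iso: "\<lbrakk>X \<in> Obj C; Y \<in> Obj C; Z \<in> Obj C\<rbrakk> \<Longrightarrow> iso_arrow C (Assoc C X Y Z)"
    and assoc_natural: "\<lbrakk>f \<in> Hom C X X'; g \<in> Hom C Y Y'; h \<in> Hom C Z Z'\<rbrakk>
      \<Longrightarrow> Assoc C X' Y' Z' \<star> ((f \<boxtimes>\<^sub>a g) \<boxtimes>\<^sub>a h) = (f \<boxtimes>\<^sub>a (g \<boxtimes>\<^sub>a h)) \<star> Assoc C X Y Z"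
    and lunit_hom: "X \<in> Obj C \<Longrightarrow> LUnit C X \<in> Hom C (Unit C \<boxtimes> X) X"
    and lunit_iso: "X \<in> Obj C \<Longrightarrow> iso_arrow C (LUnit C X)"
    and lunit_natural: "f \<in> Hom C X Y \<Longrightarrow> LUnit C Y \<star> (Ident C (Unit C) \<boxtimes>\<^sub>a f) = f \<star> LUnit C X"
    and runit_hom: "X \<in> Obj C \<Longrightarrow> RUnit C X \<in> Hom C (X \<boxtimes> Unit C) X"
    and runit_iso: "X \<in> Obj C \<Longrightarrow> iso_arrow C (RUnit C X)"
    and runit_natural: "f \<in> Hom C X Y \<Longrightarrow> RUnit C Y \<star> (f \<boxtimes>\<^sub>a Ident C (Unit C)) = f \<star> RUnit C X"
    and pentagon: "\<lbrakk>W \<in> Obj C; X \<in> Obj C; Y \<in> Obj C; Z \<in> Obj C\<rbrakk> \<Longrightarrow>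
      Assoc C W X (Y \<boxtimes> Z) \<star> Assoc C (W \<boxtimes> X) Y Z =
      (Ident C W \<boxtimes>\<^sub>a Assoc C X Y Z) \<star> Assoc C W (X \<boxtimes> Y) Z \<star> (Assoc C W X Y \<boxtimes>\<^sub>a Ident C Z)"
    and triangle: "\<lbrakk>X \<in> Obj C; Y \<in> Obj C\<rbrakk> \<Longrightarrow>
      (Ident C X \<boxtimes>\<^sub>a LUnit C Y) \<star> Assoc C X (Unit C) Y = RUnit C X \<boxtimes>\<^sub>a Ident C Y"

locale braided_category = monoidal_category C
  for C :: "('o, 'm, 'e) braided_cat_scheme" (structure) +
  assumes braid_hom: "\<lbrakk>X \<in> Obj C; Y \<in> Obj C\<rbrakk> \<Longrightarrow> Braid C X Y \<in> Hom C (X \<boxtimes> Y) (Y \<boxtimes> X)"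
    and braid_iso: "\<lbrakk>X \<in> Obj C; Y \<in> Obj C\<rbrakk> \<Longrightarrow> iso_arrow C (Braid C X Y)"
    and braid_natural: "\<lbrakk>f \<in> Hom C X X'; g \<in> Hom C Y Y'\<rbrakk>
      \<Longrightarrow> Braid C X' Y' \<star> (f \<boxtimes>\<^sub>a g) = (g \<boxtimes>\<^sub>a f) \<star> Braid C X Y"
    and hexagon1: "\<lbrakk>X \<in> Obj C; Y \<in> Obj C; Z \<in> Obj C\<rbrakk> \<Longrightarrow>
      Assoc C Y Z X \<star> Braid C X (Y \<boxtimes> Z) \<star> Assoc C X Y Z =
      (Ident C Y \<boxtimes>\<^sub>a Braid C X Z) \<star> Assoc C Y X Z \<star> (Braid C X Y \<boxtimes>\<^sub>a Ident C Z)"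
    and hexagon2: "\<lbrakk>X \<in> Obj C; Y \<in> Obj C; Z \<in> Obj C\<rbrakk> \<Longrightarrow>
      inv_arrow C (Assoc C Z X Y) \<star> Braid C (X \<boxtimes> Y) Z \<star> inv_arrow C (Assoc C X Y Z) =
      (Braid C X Z \<boxtimes>\<^sub>a Ident C Y) \<star> inv_arrow C (Assoc C X Z Y) \<star> (Ident C X \<boxtimes>\<^sub>a Braid C Y Z)"

locale balanced_category = braided_category C
  for C :: "('o, 'm, 'e) balanced_cat_scheme" (structure) +
  assumes twist_aut: "X \<in> Obj C \<Longrightarrow> Twist C X \<in> carrier (Aut C X)"
    and twist_natural: "f \<in> Hom C X Y \<Longrightarrow> Twist C Y \<star> f = f \<star> Twist C X"
    and twist_tens: "\<lbrakk>X \<in> Obj C; Y \<in> Obj C\<rbrakk> \<Longrightarrow>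
      Twist C (X \<boxtimes> Y) = (Twist C X \<boxtimes>\<^sub>a Twist C Y) \<star> Braid C Y X \<star> Braid C X Y"

locale balanced_contraction = balanced_category C + cat_functor C D Fo Fa
  for C :: "('o, 'm, 'e) balanced_cat_scheme" (structure)
    and D :: "('p, 'n, 'd) cat_scheme" and Fo Fa +
  assumes contract_swap: "\<lbrakk>X \<in> Obj C; Y \<in> Obj C\<rbrakk> \<Longrightarrow> Fo (Y \<boxtimes> X) = Fo (X \<boxtimes> Y)"
    and contract_braid: "\<lbrakk>X \<in> Obj C; Y \<in> Obj C\<rbrakk> \<Longrightarrow>
      Fa ((Twist C Y \<boxtimes>\<^sub>a Ident C X) \<star> Braid C X Y) = Ident D (Fo (X \<boxtimes> Y))"
    and contract_rebracket: "\<lbrakk>X \<in> Obj C; Y \<in> Obj C; Z \<in> Obj C\<rbrakk> \<Longrightarrow>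
      Fo ((X \<boxtimes> Y) \<boxtimes> Z) = Fo (X \<boxtimes> (Y \<boxtimes> Z))"
    and contract_assoc: "\<lbrakk>X \<in> Obj C; Y \<in> Obj C; Z \<in> Obj C\<rbrakk> \<Longrightarrow>
      Fa (Assoc C X Y Z) = Ident D (Fo (X \<boxtimes> (Y \<boxtimes> Z)))"

section \<open>Groups given by generators and relations\<close>

text \<open>A letter \<^term>\<open>(s, True)\<close> stands for the generator \<^term>\<open>s\<close>, \<^term>\<open>(s, False)\<close> for its inverse.\<close>

type_synonym 's gen_word = "('s \<times> bool) list"

inductive pres_eq :: "'s set \<Rightarrow> ('s gen_word \<times> 's gen_word) set \<Rightarrow> 's gen_word \<Rightarrow> 's gen_word \<Rightarrow> bool"
  for S R where
  refl: "w \<in> lists (S \<times> UNIV) \<Longrightarrow> pres_eq S R w w"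
| sym: "pres_eq S R u v \<Longrightarrow> pres_eq S R v u"
| trans: "pres_eq S R u v \<Longrightarrow> pres_eq S R v w \<Longrightarrow> pres_eq S R u w"
| append: "pres_eq S R u v \<Longrightarrow> pres_eq S R u' v' \<Longrightarrow> pres_eq S R (u @ u') (v @ v')"
| cancel: "s \<in> S \<Longrightarrow> pres_eq S R [(s, b), (s, \<not> b)] []"
| relation: "(u, v) \<in> R \<Longrightarrow> u \<in> lists (S \<times> UNIV) \<Longrightarrow> v \<in> lists (S \<times> UNIV) \<Longrightarrow> pres_eq S R u v"

definition word_class :: "'s set \<Rightarrow> ('s gen_word \<times> 's gen_word) set \<Rightarrow> 's gen_word \<Rightarrow> 's gen_word set"
  where "word_class S R u = {v. pres_eq S R u v}"

definition presented_group :: "'s set \<Rightarrow> ('s gen_word \<times> 's gen_word) set \<Rightarrow> 's gen_word set monoid"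
  where "presented_group S R =
    \<lparr>carrier = word_class S R ` lists (S \<times> UNIV),
     monoid.mult = (\<lambda>A B. \<Union>u\<in>A. \<Union>v\<in>B. word_class S R (u @ v)),
     one = word_class S R []\<rparr>"

fun word_eval :: "('a, 'e) monoid_scheme \<Rightarrow> ('s \<Rightarrow> 'a) \<Rightarrow> 's gen_word \<Rightarrow> 'a"
  where
  "word_eval G f [] = \<one>\<^bsub>G\<^esub>"
| "word_eval G f ((s, b) # w) = (if b then f s else inv\<^bsub>G\<^esub> (f s)) \<otimes>\<^bsub>G\<^esub> word_eval G f w"

text \<open>The map out of a presented group determined by the images of the generators; it is meaningful
  when these images satisfy the relations, so that \<^term>\<open>word_eval G f\<close> is constant on classes.\<close>

definition pres_lift :: "('a, 'e) monoid_scheme \<Rightarrow> ('s \<Rightarrow> 'a) \<Rightarrow> 's gen_word set \<Rightarrow> 'a"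
  where "pres_lift G f A = the_elem (word_eval G f ` A)"

definition list_mult :: "('a, 'e) monoid_scheme \<Rightarrow> 'a list \<Rightarrow> 'a"
  where "list_mult G xs = foldr (\<otimes>\<^bsub>G\<^esub>) xs \<one>\<^bsub>G\<^esub>"

section \<open>Braid groups\<close>

definition braid_relations :: "nat \<Rightarrow> (nat gen_word \<times> nat gen_word) set"
  where "braid_relations n =
    {([(i, True), (j, True)], [(j, True), (i, True)]) | i j. 1 \<le> i \<and> i + 2 \<le> j \<and> j < n} \<union>
    {([(i, True), (i + 1, True), (i, True)], [(i + 1, True), (i, True), (i + 1, True)])
      | i. 1 \<le> i \<and> i + 1 < n}"

definition braid_group :: "nat \<Rightarrow> nat gen_word set monoid"
  where "braid_group n = presented_group {1..<n} (braid_relations n)"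

definition braid_gen :: "nat \<Rightarrow> nat \<Rightarrow> nat gen_word set"
  where "braid_gen n i = word_class {1..<n} (braid_relations n) [(i, True)]"

definition full_twist :: "nat \<Rightarrow> nat gen_word set"
  where "full_twist n = list_mult (braid_group n) (map (braid_gen n) [1..<n]) [^]\<^bsub>braid_group n\<^esub> n"

definition full_twist_subgroup :: "nat \<Rightarrow> nat gen_word set set"
  where "full_twist_subgroup n = generate (braid_group n) {full_twist n}"

definition braid_perm :: "nat \<Rightarrow> nat gen_word set \<Rightarrow> nat \<Rightarrow> nat"
  where "braid_perm n = pres_lift (sym_group n) (\<lambda>i. transpose i (i + 1))"

definition semidirect_product ::
    "('a, 'd) monoid_scheme \<Rightarrow> ('b, 'e) monoid_scheme \<Rightarrow> ('b \<Rightarrow> 'a \<Rightarrow> 'a) \<Rightarrow> ('a \<times> 'b) monoid"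
  where "semidirect_product N H \<phi> =
    \<lparr>carrier = carrier N \<times> carrier H,
     monoid.mult = (\<lambda>(v, b) (w, c). (v \<otimes>\<^bsub>N\<^esub> \<phi> b w, b \<otimes>\<^bsub>H\<^esub> c)),
     one = (\<one>\<^bsub>N\<^esub>, \<one>\<^bsub>H\<^esub>)\<rparr>"

definition framing_lattice :: "nat \<Rightarrow> (nat \<Rightarrow> int) monoid"
  where "framing_lattice n = product_group {1..n} (\<lambda>_. integer_group)"

text \<open>The permutation of coordinates sending the \<^term>\<open>j\<close>-th basis vector to the
  \<^term>\<open>p j\<close>-th one.\<close>

definition permute_lattice :: "nat \<Rightarrow> (nat \<Rightarrow> nat) \<Rightarrow> (nat \<Rightarrow> int) \<Rightarrow> nat \<Rightarrow> int"
  where "permute_lattice n p v = (\<lambda>i\<in>{1..n}. v ((inv\<^bsub>sym_group n\<^esub> p) i))"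

definition framed_braid_group :: "nat \<Rightarrow> ((nat \<Rightarrow> int) \<times> nat gen_word set) monoid"
  where "framed_braid_group n =
    semidirect_product (framing_lattice n) (braid_group n) (\<lambda>b. permute_lattice n (braid_perm n b))"

definition framing_gen :: "nat \<Rightarrow> nat \<Rightarrow> (nat \<Rightarrow> int) \<times> nat gen_word set"
  where "framing_gen n i = ((\<lambda>j\<in>{1..n}. if j = i then 1 else 0), \<one>\<^bsub>braid_group n\<^esub>)"

definition framed_braid :: "nat \<Rightarrow> nat gen_word set \<Rightarrow> (nat \<Rightarrow> int) \<times> nat gen_word set"
  where "framed_braid n b = (\<one>\<^bsub>framing_lattice n\<^esub>, b)"

definition framed_full_twist_subgroup :: "nat \<Rightarrow> ((nat \<Rightarrow> int) \<times> nat gen_word set) set"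
  where "framed_full_twist_subgroup n = generate (framed_braid_group n)
    {list_mult (framed_braid_group n) (map (framing_gen n) [1..<n + 1])
       \<otimes>\<^bsub>framed_braid_group n\<^esub> framed_braid n (full_twist n)}"

section \<open>Tensor powers and the canonical representation\<close>

text \<open>Parenthesizations of a nonempty product of copies of one object.\<close>

datatype paren = Strand | Join paren paren

primrec strands :: "paren \<Rightarrow> nat" where
  "strands Strand = 1"
| "strands (Join s t) = strands s + strands t"

primrec power_obj :: "('o, 'm, 'e) monoidal_cat_scheme \<Rightarrow> 'o \<Rightarrow> paren \<Rightarrow> 'o" where
  "power_obj C X Strand = X"
| "power_obj C X (Join s t) = power_obj C X s \<boxtimes>\<^bsub>C\<^esub> power_obj C X t"

text \<open>The left-nested power \<open>((X \<boxtimes> X) \<boxtimes> X) \<boxtimes> \<dots>\<close>. In this and the following functions only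
  positive exponents matter.\<close>

fun left_power :: "('o, 'm, 'e) monoidal_cat_scheme \<Rightarrow> 'o \<Rightarrow> nat \<Rightarrow> 'o" where
  "left_power C X 0 = Unit C"
| "left_power C X (Suc 0) = X"
| "left_power C X (Suc (Suc k)) = left_power C X (Suc k) \<boxtimes>\<^bsub>C\<^esub> X"

text \<open>The associativity constraint from \<^term>\<open>left_power C X p \<boxtimes>\<^bsub>C\<^esub> left_power C X q\<close> to
  \<^term>\<open>left_power C X (p + q)\<close>.\<close>

fun merge_powers :: "('o, 'm, 'e) monoidal_cat_scheme \<Rightarrow> 'o \<Rightarrow> nat \<Rightarrow> nat \<Rightarrow> 'm" where
  "merge_powers C X p 0 = RUnit C (left_power C X p)"
| "merge_powers C X p (Suc 0) = Ident C (left_power C X (Suc p))"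
| "merge_powers C X p (Suc (Suc k)) =
     (merge_powers C X p (Suc k) \<boxtimes>\<^sub>a\<^bsub>C\<^esub> Ident C X)
       \<star>\<^bsub>C\<^esub> inv_arrow C (Assoc C (left_power C X p) (left_power C X (Suc k)) X)"

text \<open>The associativity constraint from \<^term>\<open>power_obj C X P\<close> to the left-nested power.\<close>

primrec left_nest :: "('o, 'm, 'e) monoidal_cat_scheme \<Rightarrow> 'o \<Rightarrow> paren \<Rightarrow> 'm" where
  "left_nest C X Strand = Ident C X"
| "left_nest C X (Join s t) =
     merge_powers C X (strands s) (strands t) \<star>\<^bsub>C\<^esub> (left_nest C X s \<boxtimes>\<^sub>a\<^bsub>C\<^esub> left_nest C X t)"

text \<open>The twist of the \<^term>\<open>i\<close>-th tensor factor, \<open>1 \<le> i \<le> strands P\<close>.\<close>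

primrec strand_twist :: "('o, 'm, 'e) balanced_cat_scheme \<Rightarrow> 'o \<Rightarrow> paren \<Rightarrow> nat \<Rightarrow> 'm" where
  "strand_twist C X Strand i = Twist C X"
| "strand_twist C X (Join s t) i =
     (if i \<le> strands s then strand_twist C X s i \<boxtimes>\<^sub>a\<^bsub>C\<^esub> Ident C (power_obj C X t)
      else Ident C (power_obj C X s) \<boxtimes>\<^sub>a\<^bsub>C\<^esub> strand_twist C X t (i - strands s))"

text \<open>The braiding of the factors \<^term>\<open>i\<close> and \<^term>\<open>i + 1\<close> of the left-nested \<^term>\<open>n\<close>-th
  power, \<open>1 \<le> i < n\<close>. If they are the last two factors, one first passes from
  \<open>(Y \<boxtimes> X) \<boxtimes> X\<close> to \<open>Y \<boxtimes> (X \<boxtimes> X)\<close>.\<close>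

primrec left_braid :: "('o, 'm, 'e) braided_cat_scheme \<Rightarrow> 'o \<Rightarrow> nat \<Rightarrow> nat \<Rightarrow> 'm" where
  "left_braid C X 0 i = Ident C (Unit C)"
| "left_braid C X (Suc m) i =
     (if i < m then left_braid C X m i \<boxtimes>\<^sub>a\<^bsub>C\<^esub> Ident C X
      else if m = 1 then Braid C X X
      else let Y = left_power C X (m - 1) in
        inv_arrow C (Assoc C Y X X) \<star>\<^bsub>C\<^esub> (Ident C Y \<boxtimes>\<^sub>a\<^bsub>C\<^esub> Braid C X X) \<star>\<^bsub>C\<^esub> Assoc C Y X X)"

definition strand_braid :: "('o, 'm, 'e) braided_cat_scheme \<Rightarrow> 'o \<Rightarrow> paren \<Rightarrow> nat \<Rightarrow> 'm"
  where "strand_braid C X P i =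
    inv_arrow C (left_nest C X P) \<star>\<^bsub>C\<^esub> left_braid C X (strands P) i \<star>\<^bsub>C\<^esub> left_nest C X P"

definition canonical_rep ::
    "('o, 'm, 'e) balanced_cat_scheme \<Rightarrow> 'o \<Rightarrow> paren \<Rightarrow> (nat \<Rightarrow> int) \<times> nat gen_word set \<Rightarrow> 'm"
  where "canonical_rep C X P = (\<lambda>(v, b).
    let A = Aut C (power_obj C X P) in
      list_mult A (map (\<lambda>i. strand_twist C X P i [^]\<^bsub>A\<^esub> v i) [1..<strands P + 1])
        \<otimes>\<^bsub>A\<^esub> pres_lift A (strand_braid C X P) b)"

end

(*
Put \<theta> for the balancing and W for the tensor power of X. The canonical representation sends the
generator of the kernel, the framed full twist, to \<theta>_W: for the left-nested power this follows by
induction from \<theta>_{Y X} = (\<theta>_Y \<theta>_X) \<beta>_{X,Y} \<beta>_{Y,X} and the hexagons, which match the identity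
z_{m+1} = z_m (\<sigma>_m ... \<sigma>_1) (\<sigma>_1 ... \<sigma>_m) in the braid group, and any other parenthesization is
conjugate to it. On the other hand a balanced contraction kills every \<theta>_W, because \<theta>_{Y X} is a composite
of two arrows of the form (\<theta>_Y id) \<beta>_{X,Y}, and every object is isomorphic to such a product.
*)

theory Submission
  imports Defs
begin

section \<open>Presented groups\<close>

text \<open>That \<open>canonical_rep\<close> is a homomorphism is itself a claim: the braid group
  consists of word classes, so every braid and framing relation must first be verified among arrows.
  The left-nested powers make this tractable, because there a new strand is added by whiskering with
  \<open>X\<close> on the right. Only relations involving the last crossing are then new, and these
  are checked after transport along explicit associators, with the pentagon and the Yang-Baxter
  equation for the last three strands. Other parenthesizations inherit the relations because
  conjugation by \<open>left_nest\<close> is an injective homomorphism. In the induction for the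
  full twist, one hexagon yields the ascending product of crossings and the other the descending
  one. Both single braidings pass through the product of \<open>X\<close> with a left-nested power,
  which is not itself left-nested; \<open>merge_powers C X 1 m\<close> repairs this and cancels in
  the double braiding.\<close>

lemma pres_eq_words:
  assumes "pres_eq S R u v"
  shows "u \<in> lists (S \<times> UNIV) \<and> v \<in> lists (S \<times> UNIV)"
  using assms by induction auto

lemma word_class_eqI:
  assumes "pres_eq S R u v"
  shows "word_class S R u = word_class S R v"
  using assms unfolding word_class_def by (auto intro: pres_eq.sym pres_eq.trans)

lemma word_class_self: "u \<in> lists (S \<times> UNIV) \<Longrightarrow> u \<in> word_class S R u"
  by (simp add: word_class_def pres_eq.refl)

lemma presented_group_mult:
  assumes "u \<in> lists (S \<times> UNIV)" "v \<in> lists (S \<times> UNIV)"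
  shows "word_class S R u \<otimes>\<^bsub>presented_group S R\<^esub> word_class S R v = word_class S R (u @ v)"
proof -
  have "word_class S R (u' @ v') = word_class S R (u @ v)"
    if "u' \<in> word_class S R u" "v' \<in> word_class S R v" for u' v'
    using that by (intro word_class_eqI pres_eq.append) (auto simp: word_class_def intro: pres_eq.sym)
  \<comment> \<open>The double union has the same value at all representatives; these memberships
    make it nonempty.\<close>
  moreover have "u \<in> word_class S R u" "v \<in> word_class S R v"
    using assms by (auto intro: word_class_self)
  ultimately have "(\<Union>u'\<in>word_class S R u. \<Union>v'\<in>word_class S R v. word_class S R (u' @ v'))
      = word_class S R (u @ v)"
    by blast
  then show ?thesis
    by (simp add: presented_group_def)
qed

lemma presented_group_one: "\<one>\<^bsub>presented_group S R\<^esub> = word_class S R []"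
  by (simp add: presented_group_def)

lemma presented_group_carrier:
  "carrier (presented_group S R) = word_class S R ` lists (S \<times> UNIV)"
  by (simp add: presented_group_def)

lemma presented_group_cases:
  assumes "x \<in> carrier (presented_group S R)"
  obtains u where "u \<in> lists (S \<times> UNIV)" "x = word_class S R u"
  using assms by (auto simp: presented_group_carrier)

lemma word_class_closed: "u \<in> lists (S \<times> UNIV) \<Longrightarrow> word_class S R u \<in> carrier (presented_group S R)"
  unfolding presented_group_carrier by (rule imageI)

definition inverse_word :: "'s gen_word \<Rightarrow> 's gen_word"
  where "inverse_word u = rev (map (\<lambda>(s, b). (s, \<not> b)) u)"

lemma inverse_word_closed: "u \<in> lists (S \<times> UNIV) \<Longrightarrow> inverse_word u \<in> lists (S \<times> UNIV)"
  by (induction u) (auto simp: inverse_word_def)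

lemma pres_eq_inverse_word:
  assumes "u \<in> lists (S \<times> UNIV)"
  shows "pres_eq S R (inverse_word u @ u) []"
  using assms
proof (induction u)
  case Nil
  then show ?case by (simp add: inverse_word_def pres_eq.refl)
next
  case (Cons x u)
  obtain s b where x: "x = (s, b)" "s \<in> S"
    using Cons.hyps by auto
  have u: "u \<in> lists (S \<times> UNIV)"
    using Cons.hyps by auto
  have "pres_eq S R ([(s, \<not> b), (s, \<not> \<not> b)] @ u) ([] @ u)"
    by (rule pres_eq.append[OF pres_eq.cancel[OF x(2)] pres_eq.refl[OF u]])
  then have "pres_eq S R (inverse_word u @ ([(s, \<not> b), (s, \<not> \<not> b)] @ u)) (inverse_word u @ ([] @ u))"
    by (rule pres_eq.append[OF pres_eq.refl[OF inverse_word_closed[OF u]]])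
  then have "pres_eq S R (inverse_word (x # u) @ x # u) (inverse_word u @ u)"
    by (simp add: x inverse_word_def)
  then show ?case
    using Cons.IH by (rule pres_eq.trans)
qed

lemma group_presented_group: "group (presented_group S R)"
proof (rule groupI)
  fix x assume "x \<in> carrier (presented_group S R)"
  then obtain u where u: "u \<in> lists (S \<times> UNIV)" "x = word_class S R u"
    by (rule presented_group_cases)
  show "\<one>\<^bsub>presented_group S R\<^esub> \<otimes>\<^bsub>presented_group S R\<^esub> x = x"
    by (simp only: u(2) presented_group_one presented_group_mult[OF lists.Nil u(1)] append_Nil)
  show "\<exists>y\<in>carrier (presented_group S R). y \<otimes>\<^bsub>presented_group S R\<^esub> x = \<one>\<^bsub>presented_group S R\<^esub>"
  proof
    show "word_class S R (inverse_word u) \<in> carrier (presented_group S R)"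
      by (intro word_class_closed inverse_word_closed u)
    show "word_class S R (inverse_word u) \<otimes>\<^bsub>presented_group S R\<^esub> x = \<one>\<^bsub>presented_group S R\<^esub>"
      by (simp only: u(2) presented_group_mult[OF inverse_word_closed[OF u(1)] u(1)] presented_group_one)
        (intro word_class_eqI pres_eq_inverse_word u)
  qed
  fix y assume "y \<in> carrier (presented_group S R)"
  then obtain v where v: "v \<in> lists (S \<times> UNIV)" "y = word_class S R v"
    by (rule presented_group_cases)
  have uv: "u @ v \<in> lists (S \<times> UNIV)"
    using u v by simp
  then show "x \<otimes>\<^bsub>presented_group S R\<^esub> y \<in> carrier (presented_group S R)"
    by (simp only: u(2) v(2) presented_group_mult[OF u(1) v(1)] word_class_closed)
  fix z assume "z \<in> carrier (presented_group S R)"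
  then obtain w where w: "w \<in> lists (S \<times> UNIV)" "z = word_class S R w"
    by (rule presented_group_cases)
  have vw: "v @ w \<in> lists (S \<times> UNIV)"
    using v w by simp
  show "x \<otimes>\<^bsub>presented_group S R\<^esub> y \<otimes>\<^bsub>presented_group S R\<^esub> z
      = x \<otimes>\<^bsub>presented_group S R\<^esub> (y \<otimes>\<^bsub>presented_group S R\<^esub> z)"
    by (simp only: u(2) v(2) w(2) presented_group_mult[OF u(1) v(1)] presented_group_mult[OF v(1) w(1)]
        presented_group_mult[OF uv w(1)] presented_group_mult[OF u(1) vw] append_assoc)
qed (simp add: presented_group_one word_class_closed)

definition gen_class :: "'s set \<Rightarrow> ('s gen_word \<times> 's gen_word) set \<Rightarrow> 's \<Rightarrow> 's gen_word set"
  where "gen_class S R s = word_class S R [(s, True)]"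

lemma gen_class_closed: "s \<in> S \<Longrightarrow> gen_class S R s \<in> carrier (presented_group S R)"
  by (simp add: gen_class_def presented_group_carrier)

lemma word_class_letter:
  assumes "s \<in> S"
  shows "word_class S R [(s, b)] =
    (if b then gen_class S R s else inv\<^bsub>presented_group S R\<^esub> gen_class S R s)"
proof -
  interpret P: group "presented_group S R" by (rule group_presented_group)
  have "word_class S R [(s, False)] \<otimes>\<^bsub>presented_group S R\<^esub> gen_class S R s = word_class S R [(s, False), (s, \<not> False)]"
    using assms by (simp add: gen_class_def presented_group_mult)
  also have "\<dots> = \<one>\<^bsub>presented_group S R\<^esub>"
    unfolding presented_group_one by (intro word_class_eqI pres_eq.cancel assms)
  finally have "inv\<^bsub>presented_group S R\<^esub> gen_class S R s = word_class S R [(s, False)]"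
    using assms by (intro P.inv_equality gen_class_closed) (auto simp: presented_group_carrier)
  then show ?thesis
    by (cases b) (simp_all add: gen_class_def)
qed

text \<open>Statements about all braids, such as centrality of the full twist and equivariance on
  framings, are reduced to the generators by this rule, so that words do not reappear in their
  proofs.\<close>

lemma presented_group_induct [consumes 1, case_names one gen inv mult]:
  assumes "b \<in> carrier (presented_group S R)"
    and one: "P \<one>\<^bsub>presented_group S R\<^esub>"
    and gen: "\<And>s. s \<in> S \<Longrightarrow> P (gen_class S R s)"
    and inv: "\<And>x. \<lbrakk>x \<in> carrier (presented_group S R); P x\<rbrakk> \<Longrightarrow> P (inv\<^bsub>presented_group S R\<^esub> x)"
    and mult: "\<And>x y. \<lbrakk>x \<in> carrier (presented_group S R); y \<in> carrier (presented_group S R); P x; P y\<rbrakk>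
      \<Longrightarrow> P (x \<otimes>\<^bsub>presented_group S R\<^esub> y)"
  shows "P b"
proof -
  obtain u where u: "u \<in> lists (S \<times> UNIV)" "b = word_class S R u"
    using assms by (auto simp: presented_group_carrier)
  from u(1) have "P (word_class S R u)"
  proof (induction u)
    case Nil
    then show ?case using one by (simp add: presented_group_one)
  next
    case (Cons x u)
    obtain s b where x: "x = (s, b)" "s \<in> S"
      using Cons.hyps by auto
    have u: "u \<in> lists (S \<times> UNIV)"
      using Cons.hyps by auto
    have "word_class S R (x # u) = word_class S R [(s, b)] \<otimes>\<^bsub>presented_group S R\<^esub> word_class S R u"
      using x u by (simp add: presented_group_mult)
    moreover have "P (word_class S R [(s, b)])"
      using x by (simp add: word_class_letter gen inv gen_class_closed)
    moreover have "word_class S R [(s, b)] \<in> carrier (presented_group S R)"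
        "word_class S R u \<in> carrier (presented_group S R)"
      unfolding presented_group_carrier by (rule imageI, use x u in simp)+
    ultimately show ?case
      using Cons.IH by (simp add: mult)
  qed
  then show ?thesis by (simp add: u)
qed

text \<open>These are the hypotheses of von Dyck's theorem; its conclusion is
  \<open>pres_lift_hom\<close> together with \<open>pres_lift_gen_class\<close>.\<close>

locale presentation_images = group G for G :: "('a, 'e) monoid_scheme" (structure) +
  fixes S :: "'s set" and R and f :: "'s \<Rightarrow> 'a"
  assumes image_closed: "s \<in> S \<Longrightarrow> f s \<in> carrier G"
    and image_relation: "\<lbrakk>(u, v) \<in> R; u \<in> lists (S \<times> UNIV); v \<in> lists (S \<times> UNIV)\<rbrakk>
      \<Longrightarrow> word_eval G f u = word_eval G f v"
begin

lemma word_eval_closed: "u \<in> lists (S \<times> UNIV) \<Longrightarrow> word_eval G f u \<in> carrier G"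
  by (induction u) (auto simp: image_closed)

lemma word_eval_append:
  "\<lbrakk>u \<in> lists (S \<times> UNIV); v \<in> lists (S \<times> UNIV)\<rbrakk>
    \<Longrightarrow> word_eval G f (u @ v) = word_eval G f u \<otimes> word_eval G f v"
proof (induction u)
  case Nil
  then show ?case by (simp add: word_eval_closed)
next
  case (Cons x u)
  then have "snd x \<or> \<not> snd x" "fst x \<in> S" "u \<in> lists (S \<times> UNIV)"
    by auto
  then show ?case
    using Cons by (cases x) (simp add: m_assoc word_eval_closed image_closed)
qed

lemma word_eval_pres_eq:
  assumes "pres_eq S R u v"
  shows "word_eval G f u = word_eval G f v"
  using assms
proof induction
  case (append u v u' v')
  then show ?case
    using pres_eq_words[OF append.hyps(1)] pres_eq_words[OF append.hyps(2)]
    by (simp add: word_eval_append)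
next
  case (cancel s b)
  then show ?case by (simp add: image_closed)
qed (auto simp: image_relation)

text \<open>Evaluation is constant on a class, so its image is a singleton and
  \<open>the_elem\<close> returns a genuine value.\<close>

lemma pres_lift_word_class:
  assumes "u \<in> lists (S \<times> UNIV)"
  shows "pres_lift G f (word_class S R u) = word_eval G f u"
proof -
  have "word_eval G f ` word_class S R u = {word_eval G f u}"
    using word_class_self[OF assms, of R]
    by (auto simp: word_class_def dest: word_eval_pres_eq)
  then show ?thesis by (simp add: pres_lift_def)
qed

lemma pres_lift_hom: "pres_lift G f \<in> hom (presented_group S R) G"
proof (rule homI)
  show "pres_lift G f x \<in> carrier G" if "x \<in> carrier (presented_group S R)" for x
    using that by (elim presented_group_cases) (simp only: pres_lift_word_class word_eval_closed)
  show "pres_lift G f (x \<otimes>\<^bsub>presented_group S R\<^esub> y) = pres_lift G f x \<otimes> pres_lift G f y"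
    if xy: "x \<in> carrier (presented_group S R)" "y \<in> carrier (presented_group S R)" for x y
  proof -
    obtain u v where "u \<in> lists (S \<times> UNIV)" "x = word_class S R u"
        "v \<in> lists (S \<times> UNIV)" "y = word_class S R v"
      using xy by (auto simp: presented_group_carrier)
    moreover from this have "u @ v \<in> lists (S \<times> UNIV)"
      by simp
    ultimately show ?thesis
      by (simp only: presented_group_mult pres_lift_word_class word_eval_append)
  qed
qed

lemma pres_lift_gen_class: "s \<in> S \<Longrightarrow> pres_lift G f (gen_class S R s) = f s"
  by (simp add: gen_class_def pres_lift_word_class image_closed)

end

section \<open>Products of lists\<close>

context group
begin

lemma list_mult_Nil: "list_mult G [] = \<one>"
  by (simp add: list_mult_def)

lemma list_mult_Cons: "list_mult G (x # xs) = x \<otimes> list_mult G xs"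
  by (simp add: list_mult_def)

lemma list_mult_closed: "set xs \<subseteq> carrier G \<Longrightarrow> list_mult G xs \<in> carrier G"
  by (induction xs) (auto simp: list_mult_Nil list_mult_Cons)

lemma list_mult_append:
  "\<lbrakk>set xs \<subseteq> carrier G; set ys \<subseteq> carrier G\<rbrakk>
    \<Longrightarrow> list_mult G (xs @ ys) = list_mult G xs \<otimes> list_mult G ys"
  by (induction xs) (auto simp: list_mult_Nil list_mult_Cons list_mult_closed m_assoc)

lemma list_mult_snoc:
  "\<lbrakk>set xs \<subseteq> carrier G; x \<in> carrier G\<rbrakk> \<Longrightarrow> list_mult G (xs @ [x]) = list_mult G xs \<otimes> x"
  by (simp add: list_mult_append list_mult_Nil list_mult_Cons)

lemma list_mult_one: "set xs \<subseteq> {\<one>} \<Longrightarrow> list_mult G xs = \<one>"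
  by (induction xs) (auto simp: list_mult_Nil list_mult_Cons)

text \<open>\<open>g\<close> is carried through the product one factor at a time. With
  \<open>u = w\<close> this is commutation; with different \<open>u\<close> and \<open>w\<close> it
  expresses the index shift caused by an ascending product and the renaming of framings by a
  crossing.\<close>

lemma list_mult_intertwine:
  assumes "g \<in> carrier G" "\<And>x. x \<in> set xs \<Longrightarrow> u x \<in> carrier G" "\<And>x. x \<in> set xs \<Longrightarrow> w x \<in> carrier G"
    and "\<And>x. x \<in> set xs \<Longrightarrow> g \<otimes> u x = w x \<otimes> g"
  shows "g \<otimes> list_mult G (map u xs) = list_mult G (map w xs) \<otimes> g"
  using assms(2-)
proof (induction xs)
  case Nil
  then show ?case by (simp add: list_mult_Nil assms(1))
next
  case (Cons x xs)
  have closed: "list_mult G (map u xs) \<in> carrier G" "list_mult G (map w xs) \<in> carrier G"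
    by (rule list_mult_closed, use Cons.prems in force)+
  have "g \<otimes> list_mult G (map u (x # xs)) = (g \<otimes> u x) \<otimes> list_mult G (map u xs)"
    using Cons.prems(1) closed assms(1) by (simp add: list_mult_Cons m_assoc)
  also have "\<dots> = w x \<otimes> (g \<otimes> list_mult G (map u xs))"
    using Cons.prems closed assms(1) by (simp add: m_assoc)
  also have "g \<otimes> list_mult G (map u xs) = list_mult G (map w xs) \<otimes> g"
    using Cons by simp
  finally show ?case
    using Cons.prems closed assms(1) by (simp add: list_mult_Cons m_assoc)
qed

lemma list_mult_remove:
  assumes closed: "\<And>x. x \<in> set (xs @ a # ys) \<Longrightarrow> u x \<in> carrier G"
    and comm: "\<And>x. x \<in> set xs \<Longrightarrow> u a \<otimes> u x = u x \<otimes> u a"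
  shows "list_mult G (map u (xs @ a # ys)) = u a \<otimes> list_mult G (map u (xs @ ys))"
proof -
  have xs: "set (map u xs) \<subseteq> carrier G" and ys: "set (map u ys) \<subseteq> carrier G" and a: "u a \<in> carrier G"
    using closed by auto
  have "list_mult G (map u xs) \<otimes> u a = u a \<otimes> list_mult G (map u xs)"
    using closed comm by (intro list_mult_intertwine[symmetric]) auto
  moreover have "list_mult G (map u xs) \<in> carrier G" "list_mult G (map u ys) \<in> carrier G"
    using xs ys by (auto intro!: list_mult_closed)
  moreover have "list_mult G (map u (xs @ ys)) = list_mult G (map u xs) \<otimes> list_mult G (map u ys)"
    using xs ys by (simp add: list_mult_append)
  moreover have "list_mult G (map u (xs @ a # ys))
      = list_mult G (map u xs) \<otimes> (u a \<otimes> list_mult G (map u ys))"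
    using xs ys a by (simp add: list_mult_append list_mult_Cons)
  ultimately show ?thesis
    using a by (metis m_assoc)
qed

text \<open>The ambient group need not be commutative, only the listed factors commute. The head of
  \<open>xs\<close> is located in \<open>ys\<close> and pulled to the front there; induction handles
  the rest.\<close>

lemma list_mult_permute:
  assumes "mset xs = mset ys"
    and "\<And>x. x \<in> set xs \<Longrightarrow> u x \<in> carrier G"
    and "\<And>x y. \<lbrakk>x \<in> set xs; y \<in> set xs\<rbrakk> \<Longrightarrow> u x \<otimes> u y = u y \<otimes> u x"
  shows "list_mult G (map u xs) = list_mult G (map u ys)"
  using assms
proof (induction xs arbitrary: ys)
  case Nil
  then show ?case by simp
next
  case (Cons a xs)
  have "a \<in> set ys"
    using Cons.prems(1) by (metis list.set_intros(1) set_mset_mset)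
  then obtain y1 y2 where ys: "ys = y1 @ a # y2"
    by (meson split_list)
  have mset: "mset xs = mset (y1 @ y2)"
    using Cons.prems(1) by (simp add: ys)
  then have set: "set (y1 @ y2) = set xs"
    by (metis set_mset_mset)
  have "list_mult G (map u ys) = u a \<otimes> list_mult G (map u (y1 @ y2))"
    unfolding ys using Cons.prems set by (intro list_mult_remove) auto
  also have "list_mult G (map u (y1 @ y2)) = list_mult G (map u xs)"
    using Cons.prems by (intro Cons.IH[OF mset, symmetric]) auto
  finally show ?case by (simp add: list_mult_Cons)
qed

lemma list_mult_mult:
  assumes closed: "\<And>x. x \<in> set xs \<Longrightarrow> u x \<in> carrier G" "\<And>x. x \<in> set xs \<Longrightarrow> w x \<in> carrier G"
    and comm: "\<And>x y. \<lbrakk>x \<in> set xs; y \<in> set xs\<rbrakk> \<Longrightarrow> u x \<otimes> w y = w y \<otimes> u x"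
  shows "list_mult G (map (\<lambda>x. u x \<otimes> w x) xs) = list_mult G (map u xs) \<otimes> list_mult G (map w xs)"
  using assms
proof (induction xs)
  case Nil
  then show ?case by (simp add: list_mult_Nil)
next
  case (Cons x xs)
  have mem: "list_mult G (map u xs) \<in> carrier G" "list_mult G (map w xs) \<in> carrier G"
      "u x \<in> carrier G" "w x \<in> carrier G"
    using Cons.prems by (auto intro!: list_mult_closed)
  have "w x \<otimes> list_mult G (map u xs) = list_mult G (map u xs) \<otimes> w x"
    using Cons.prems by (intro list_mult_intertwine) auto
  moreover have "list_mult G (map (\<lambda>x. u x \<otimes> w x) xs) = list_mult G (map u xs) \<otimes> list_mult G (map w xs)"
    using Cons by simp
  ultimately show ?case
    using mem by (simp add: list_mult_Cons m_assoc) (simp flip: m_assoc)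
qed

end

lemma (in group_hom) hom_list_mult:
  assumes "set xs \<subseteq> carrier G"
  shows "h (list_mult G xs) = list_mult H (map h xs)"
  using assms by (induction xs) (auto simp: G.list_mult_Nil H.list_mult_Nil G.list_mult_Cons
      H.list_mult_Cons G.list_mult_closed)

section \<open>The braid relations\<close>

text \<open>Kept abstract because it is instantiated in the braid group, in the symmetric group and
  in automorphism groups: the identities for powers of sigma_1 ... sigma_m are derived once, from
  the relations alone.\<close>

locale braid_images = group G for G :: "('a, 'e) monoid_scheme" (structure) +
  fixes N :: nat and f :: "nat \<Rightarrow> 'a"
  assumes gen_closed: "\<lbrakk>1 \<le> i; i < N\<rbrakk> \<Longrightarrow> f i \<in> carrier G"
    and far: "\<lbrakk>1 \<le> i; i + 2 \<le> j; j < N\<rbrakk> \<Longrightarrow> f i \<otimes> f j = f j \<otimes> f i"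
    and near: "\<lbrakk>1 \<le> i; i + 1 < N\<rbrakk> \<Longrightarrow> f i \<otimes> (f (i + 1) \<otimes> f i) = f (i + 1) \<otimes> (f i \<otimes> f (i + 1))"
begin

definition ascent :: "nat \<Rightarrow> 'a"
  where "ascent m = list_mult G (map f [1..<Suc m])"

definition descent :: "nat \<Rightarrow> 'a"
  where "descent m = list_mult G (map f (rev [1..<Suc m]))"

lemma gens_closed: "k \<le> N \<Longrightarrow> set (map f [1..<k]) \<subseteq> carrier G"
  using gen_closed by auto

lemma ascent_closed [simp]: "m < N \<Longrightarrow> ascent m \<in> carrier G"
  unfolding ascent_def by (intro list_mult_closed gens_closed) simp

lemma descent_closed [simp]: "m < N \<Longrightarrow> descent m \<in> carrier G"
  unfolding descent_def using gens_closed[of "Suc m"] by (intro list_mult_closed) simp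

lemma ascent_0 [simp]: "ascent 0 = \<one>"
  by (simp add: ascent_def list_mult_Nil)

lemma ascent_Suc: "Suc m < N \<Longrightarrow> ascent (Suc m) = ascent m \<otimes> f (Suc m)"
  using gens_closed[of "Suc m"] gen_closed[of "Suc m"]
  unfolding ascent_def by (simp add: list_mult_snoc)

lemma descent_0 [simp]: "descent 0 = \<one>"
  by (simp add: descent_def list_mult_Nil)

lemma descent_Suc: "descent (Suc m) = f (Suc m) \<otimes> descent m"
  by (simp add: descent_def list_mult_Cons)

lemma ascent_far:
  assumes "m + 2 \<le> j" "j < N"
  shows "f j \<otimes> ascent m = ascent m \<otimes> f j"
  unfolding ascent_def using assms gen_closed far[of _ j]
  by (intro list_mult_intertwine) auto

text \<open>\<open>f i\<close> passes the last letter \<open>f (Suc k)\<close> freely unless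
  \<open>i = k\<close>. In that case the braid relation on the last two letters produces
  \<open>f (k + 1)\<close> on the left, and this commutes with the remaining shorter ascent.\<close>

lemma ascent_shift:
  assumes "1 \<le> i" "i < m" "m < N"
  shows "ascent m \<otimes> f i = f (Suc i) \<otimes> ascent m"
  using assms
proof (induction m)
  case 0
  then show ?case by simp
next
  case (Suc k)
  have closed: "ascent k \<in> carrier G" "f i \<in> carrier G" "f (Suc i) \<in> carrier G" "f (Suc k) \<in> carrier G"
    using Suc.prems by (auto intro: gen_closed)
  have k: "ascent (Suc k) = ascent k \<otimes> f (Suc k)"
    using Suc.prems by (simp add: ascent_Suc)
  show ?case
  proof (cases "i = k")
    case True
    then obtain l where l: "k = Suc l"
      using Suc.prems by (cases k) auto
    have ak: "ascent k = ascent l \<otimes> f k" and al: "ascent l \<in> carrier G"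
      using Suc.prems by (auto simp: l ascent_Suc)
    have "ascent (Suc k) \<otimes> f i = ascent l \<otimes> (f k \<otimes> (f (k + 1) \<otimes> f k))"
      using closed al by (simp add: k ak True m_assoc)
    also have "\<dots> = (ascent l \<otimes> f (k + 1)) \<otimes> (f k \<otimes> f (k + 1))"
      using closed al Suc.prems near[of k] True by (simp add: m_assoc)
    also have "ascent l \<otimes> f (k + 1) = f (k + 1) \<otimes> ascent l"
      using Suc.prems by (intro ascent_far[symmetric]) (auto simp: l)
    finally show ?thesis
      using closed al by (simp add: k ak True m_assoc)
  next
    case False
    then have "ascent (Suc k) \<otimes> f i = ascent k \<otimes> f i \<otimes> f (Suc k)"
      using closed Suc.prems far[of i "Suc k"] by (simp add: k m_assoc)
    also have "\<dots> = f (Suc i) \<otimes> ascent (Suc k)"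
      using closed Suc False by (simp add: k m_assoc)
    finally show ?thesis .
  qed
qed

text \<open>Each further factor is pulled left across the accumulated tail. By
  \<open>ascent_shift\<close> this lowers every index in the tail by one, and splitting off the last
  letter of the factor lengthens the tail. The bound on \<open>k\<close> keeps the truncated
  differences in the tail at least 1.\<close>

lemma ascent_power:
  assumes "k \<le> Suc p" "Suc p < N"
  shows "ascent (Suc p) [^] k = ascent p [^] k \<otimes> list_mult G (map (\<lambda>i. f (Suc p - i)) [0..<k])"
  using assms(1)
proof (induction k)
  case 0
  then show ?case by (simp add: list_mult_Nil)
next
  case (Suc k)
  let ?u = "list_mult G (map (\<lambda>i. f (Suc p - i)) [0..<k])"
  let ?v = "list_mult G (map (\<lambda>i. f (p - i)) [0..<k])"
  have mem: "f (Suc p - i) \<in> carrier G" "f (p - i) \<in> carrier G" if "i < k" for i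
    using that Suc.prems assms(2) by (auto intro!: gen_closed)
  have closed: "ascent p \<in> carrier G" "ascent (Suc p) \<in> carrier G" "f (Suc p) \<in> carrier G"
      "?u \<in> carrier G" "?v \<in> carrier G"
    using assms(2) mem by (auto intro: gen_closed intro!: list_mult_closed)
  have "ascent (Suc p) \<otimes> ?v = ?u \<otimes> ascent (Suc p)"
  proof (rule list_mult_intertwine)
    fix i assume "i \<in> set [0..<k]"
    then have "Suc (p - i) = Suc p - i" "1 \<le> p - i" "p - i < Suc p"
      using Suc.prems by auto
    then show "ascent (Suc p) \<otimes> f (p - i) = f (Suc p - i) \<otimes> ascent (Suc p)"
      using ascent_shift[of "p - i" "Suc p"] assms(2) by simp
  qed (use closed mem in auto)
  then have "ascent (Suc p) [^] Suc k = ascent p [^] k \<otimes> (ascent (Suc p) \<otimes> ?v)"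
    using Suc closed by (simp add: m_assoc)
  also have "\<dots> = ascent p [^] Suc k \<otimes> (f (Suc p) \<otimes> ?v)"
    using closed assms(2) by (simp add: ascent_Suc m_assoc)
  also have "f (Suc p) \<otimes> ?v = list_mult G (map (\<lambda>i. f (Suc p - i)) [0..<Suc k])"
    by (subst upt_conv_Cons) (simp_all add: list_mult_Cons comp_def flip: map_Suc_upt del: upt_Suc)
  finally show ?case .
qed

text \<open>At exponent \<open>Suc p\<close> the tail of \<open>ascent_power\<close> has run through
  all generators and equals \<open>descent (Suc p)\<close>; one more factor remains. In terms of
  full twists this is the passage from p + 1 to p + 2 strands.\<close>

theorem ascent_full_power:
  assumes "Suc p < N"
  shows "ascent (Suc p) [^] Suc (Suc p) = ascent p [^] Suc p \<otimes> (descent (Suc p) \<otimes> ascent (Suc p))"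
proof -
  have "map (\<lambda>i. f (Suc p - i)) [0..<Suc p] = map f (rev [1..<Suc (Suc p)])"
    by (rule nth_equalityI) (simp_all add: rev_nth Suc_diff_le del: upt_Suc)
  then have "ascent (Suc p) [^] Suc p = ascent p [^] Suc p \<otimes> descent (Suc p)"
    using ascent_power[of "Suc p" p] assms by (simp add: descent_def del: upt_Suc)
  then show ?thesis
    using assms by (simp add: m_assoc)
qed

text \<open>\<open>ascent_shift\<close> says nothing about the top generator; the square of the
  ascent brings it back to \<open>f 1\<close>. The ascent is both \<open>f 1\<close> times a tail
  and a shorter ascent times \<open>f m\<close>, and moving the full ascent past the shorter one
  turns the latter into the tail.\<close>

lemma ascent_twice:
  assumes "1 \<le> m" "m < N"
  shows "ascent m \<otimes> (ascent m \<otimes> f m) = f 1 \<otimes> (ascent m \<otimes> ascent m)"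
proof -
  obtain l where l: "m = Suc l"
    using assms by (cases m) auto
  let ?v = "list_mult G (map (\<lambda>i. f (Suc i)) [1..<m])"
  have closed: "ascent l \<in> carrier G" "ascent m \<in> carrier G" "f m \<in> carrier G" "f 1 \<in> carrier G"
      "?v \<in> carrier G"
    using assms l by (auto intro!: gen_closed list_mult_closed)
  have tail: "ascent m = f 1 \<otimes> ?v"
    unfolding ascent_def using assms
    by (subst upt_conv_Cons) (simp_all add: list_mult_Cons comp_def flip: map_Suc_upt del: upt_Suc)
  have "ascent m \<otimes> ascent l = ?v \<otimes> ascent m"
    unfolding ascent_def[of l] l[symmetric] using assms closed
    by (intro list_mult_intertwine ascent_shift) (auto intro: gen_closed)
  then have "f 1 \<otimes> (ascent m \<otimes> (ascent l \<otimes> f m)) = f 1 \<otimes> (?v \<otimes> (ascent m \<otimes> f m))"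
    using closed by (simp flip: m_assoc)
  moreover have "ascent l \<otimes> f m = ascent m"
    using assms by (simp add: l ascent_Suc)
  ultimately show ?thesis
    using closed tail by (simp flip: m_assoc)
qed

lemma ascent_power_shift:
  assumes "1 \<le> i" "i + k \<le> m" "m < N"
  shows "ascent m [^] k \<otimes> f i = f (i + k) \<otimes> ascent m [^] k"
  using assms(2)
proof (induction k)
  case 0
  then show ?case using assms gen_closed[of i] by simp
next
  case (Suc k)
  have closed: "ascent m \<in> carrier G" "f i \<in> carrier G" "f (i + k) \<in> carrier G" "f (i + Suc k) \<in> carrier G"
    using Suc.prems assms by (auto intro: gen_closed)
  have "ascent m [^] Suc k \<otimes> f i = ascent m \<otimes> (ascent m [^] k \<otimes> f i)"
    using closed by (simp only: nat_pow_Suc2 m_assoc nat_pow_closed)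
  also have "\<dots> = (ascent m \<otimes> f (i + k)) \<otimes> ascent m [^] k"
    using Suc closed by (simp add: m_assoc)
  also have "\<dots> = f (i + Suc k) \<otimes> (ascent m \<otimes> ascent m [^] k)"
    using ascent_shift[of "i + k" m] Suc.prems assms closed by (simp add: m_assoc)
  finally show ?case
    using closed by (simp only: nat_pow_Suc2)
qed

text \<open>Conjugation by \<open>c\<close> raises indices by one up to \<open>m = N - 1\<close>,
  and conjugation by its square carries \<open>f m\<close> to \<open>f 1\<close>. Hence
  \<open>f i\<close> returns to itself after (m - i) + 2 + (i - 1) = N factors.\<close>

theorem ascent_power_central:
  assumes "1 \<le> i" "i < N"
  shows "ascent (N - 1) [^] N \<otimes> f i = f i \<otimes> ascent (N - 1) [^] N"
proof -
  define m where "m = N - 1"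
  define c where "c = ascent m"
  have m: "1 \<le> m" "m < N" "i \<le> m"
    using assms by (auto simp: m_def)
  have closed: "c \<in> carrier G" "f i \<in> carrier G" "f m \<in> carrier G" "f 1 \<in> carrier G"
    using assms m by (auto simp: c_def intro: gen_closed)
  have N: "N = (i - 1) + (2 + (m - i))"
    using assms by (simp add: m_def)
  have two: "c [^] (2::nat) = c \<otimes> c"
    using closed by (simp add: numeral_2_eq_2)
  have pow: "c [^] N = c [^] (i - 1) \<otimes> (c [^] (2::nat) \<otimes> c [^] (m - i))"
    using closed by (subst N) (simp only: nat_pow_mult)
  have 1: "c [^] (m - i) \<otimes> f i = f m \<otimes> c [^] (m - i)"
    using ascent_power_shift[of i "m - i" m] m assms by (simp add: c_def)
  have 2: "c [^] (2::nat) \<otimes> f m = f 1 \<otimes> c [^] (2::nat)"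
    using ascent_twice[of m, folded c_def] m closed by (simp add: two m_assoc)
  have 3: "c [^] (i - 1) \<otimes> f 1 = f i \<otimes> c [^] (i - 1)"
    using ascent_power_shift[of 1 "i - 1" m] m assms by (simp add: c_def)
  have "c [^] N \<otimes> f i = c [^] (i - 1) \<otimes> ((c [^] (2::nat) \<otimes> f m) \<otimes> c [^] (m - i))"
    using closed 1 by (simp add: pow m_assoc)
  also have "\<dots> = (c [^] (i - 1) \<otimes> f 1) \<otimes> (c [^] (2::nat) \<otimes> c [^] (m - i))"
    using closed 2 by (simp add: m_assoc)
  also have "\<dots> = f i \<otimes> c [^] N"
    using closed 3 by (simp add: pow m_assoc)
  finally show ?thesis
    by (simp add: c_def m_def)
qed

lemma presentation_images: "presentation_images G {1..<N} (braid_relations N) f"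
proof
  show "f s \<in> carrier G" if "s \<in> {1..<N}" for s
    using that by (simp add: gen_closed)
  show "word_eval G f u = word_eval G f v" if "(u, v) \<in> braid_relations N" for u v
    using that far near gen_closed by (auto simp: braid_relations_def)
qed

end

section \<open>Quotients\<close>

lemma (in group) intertwine_inv:
  assumes "g \<in> carrier G" "x \<in> carrier G" "y \<in> carrier G" "g \<otimes> x = y \<otimes> g"
  shows "g \<otimes> inv x = inv y \<otimes> g" "inv g \<otimes> y = x \<otimes> inv g"
proof -
  have "inv y \<otimes> g = inv y \<otimes> (g \<otimes> x) \<otimes> inv x"
    using assms(1-3) by (simp add: m_assoc)
  also have "\<dots> = g \<otimes> inv x"
    using assms(1-3) unfolding assms(4) by (simp flip: m_assoc)
  finally show "g \<otimes> inv x = inv y \<otimes> g" ..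
  have "inv g \<otimes> y = inv g \<otimes> (y \<otimes> g) \<otimes> inv g"
    using assms(1-3) by (simp add: m_assoc)
  also have "\<dots> = x \<otimes> inv g"
    using assms(1-3) unfolding assms(4)[symmetric] by (simp flip: m_assoc)
  finally show "inv g \<otimes> y = x \<otimes> inv g" .
qed

lemma (in group) central_generate:
  assumes z: "z \<in> carrier G" and central: "\<And>x. x \<in> carrier G \<Longrightarrow> x \<otimes> z = z \<otimes> x"
  shows "normal (generate G {z}) G"
proof -
  have sub: "subgroup (generate G {z}) G"
    using z by (simp add: generate_is_subgroup)
  have comm: "x \<otimes> h = h \<otimes> x" if "h \<in> generate G {z}" "x \<in> carrier G" for h x
    using that(1)
  proof induction
    case (inv h)
    then show ?case
      using intertwine_inv(1)[OF that(2) z z central[OF that(2)]] by simp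
  next
    case (eng h1 h2)
    then have "h1 \<in> carrier G" "h2 \<in> carrier G"
      using sub subgroup.mem_carrier by fastforce+
    then show ?case
      using eng that(2) by (metis m_assoc)
  qed (use that central in auto)
  have "x \<otimes> h \<otimes> inv x \<in> generate G {z}" if "h \<in> generate G {z}" "x \<in> carrier G" for h x
    using comm[OF that] subgroup.mem_carrier[OF sub that(1)] that by (simp add: m_assoc)
  then show ?thesis
    using sub by (simp add: normal_inv_iff)
qed

text \<open>The universal property of the quotient. The induced map picks the common value of
  \<open>h\<close> on a coset, which exists because \<open>h\<close> is trivial on
  \<open>H\<close>.\<close>

lemma (in normal) factor_lift:
  assumes "group K" "h \<in> hom G K" "\<And>x. x \<in> H \<Longrightarrow> h x = \<one>\<^bsub>K\<^esub>"
  shows "\<exists>r \<in> hom (G Mod H) K. \<forall>g\<in>carrier G. r (H #> g) = h g"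
proof -
  interpret h: group_hom G K h
    using assms by (simp add: group_hom_def group_hom_axioms_def is_group)
  define r where "r = (\<lambda>A. the_elem (h ` A))"
  have r: "r (H #> g) = h g" if "g \<in> carrier G" for g
  proof -
    have "h ` (H #> g) = {h g}"
      using that assms(3) subgroup.one_closed[OF is_subgroup] subset
      by (force simp: r_coset_def)
    then show ?thesis by (simp add: r_def)
  qed
  have "r \<in> hom (G Mod H) K"
  proof (rule homI)
    fix A assume "A \<in> carrier (G Mod H)"
    then obtain a where a: "a \<in> carrier G" "A = H #> a"
      by (auto simp: FactGroup_def RCOSETS_def)
    then show "r A \<in> carrier K"
      by (simp add: r)
    fix B assume "B \<in> carrier (G Mod H)"
    then obtain b where b: "b \<in> carrier G" "B = H #> b"
      by (auto simp: FactGroup_def RCOSETS_def)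
    show "r (A \<otimes>\<^bsub>G Mod H\<^esub> B) = r A \<otimes>\<^bsub>K\<^esub> r B"
      using a b by (simp add: FactGroup_def rcos_sum r)
  qed
  then show ?thesis using r by blast
qed

text \<open>Equality of \<open>M\<close> with the image of \<open>N\<close>, rather than inclusion,
  makes the image of a coset a whole coset. The direct image itself can therefore serve as the
  induced homomorphism.\<close>

lemma (in group_hom) image_FactGroup:
  assumes N: "normal N G" and M: "normal M H" and NM: "h ` N = M"
  shows "\<And>g. g \<in> carrier G \<Longrightarrow> h ` (N #> g) = M #>\<^bsub>H\<^esub> h g"
    and "(\<lambda>K. h ` K) \<in> hom (G Mod N) (H Mod M)"
proof -
  interpret N: normal N G by (rule N)
  interpret M: normal M H by (rule M)
  show coset: "h ` (N #> g) = M #>\<^bsub>H\<^esub> h g" if "g \<in> carrier G" for g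
    using that N.subset unfolding r_coset_def NM[symmetric] by (auto simp: image_iff subset_iff)
  show "(\<lambda>K. h ` K) \<in> hom (G Mod N) (H Mod M)"
  proof (rule homI)
    fix A assume "A \<in> carrier (G Mod N)"
    then obtain a where a: "a \<in> carrier G" "A = N #> a"
      by (auto simp: FactGroup_def RCOSETS_def)
    then show "h ` A \<in> carrier (H Mod M)"
      by (auto simp: FactGroup_def RCOSETS_def coset)
    fix B assume "B \<in> carrier (G Mod N)"
    then obtain b where b: "b \<in> carrier G" "B = N #> b"
      by (auto simp: FactGroup_def RCOSETS_def)
    show "h ` (A \<otimes>\<^bsub>G Mod N\<^esub> B) = h ` A \<otimes>\<^bsub>H Mod M\<^esub> h ` B"
      using a b by (simp add: FactGroup_def N.rcos_sum M.rcos_sum coset)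
  qed
qed

section \<open>Semidirect products\<close>

locale group_automorphism_action = N: group N + H: group H
  for N :: "('a, 'd) monoid_scheme" and H :: "('b, 'e) monoid_scheme" +
  fixes \<phi> :: "'b \<Rightarrow> 'a \<Rightarrow> 'a"
  assumes act_hom: "b \<in> carrier H \<Longrightarrow> \<phi> b \<in> hom N N"
    and act_one: "v \<in> carrier N \<Longrightarrow> \<phi> \<one>\<^bsub>H\<^esub> v = v"
    and act_mult: "\<lbrakk>b \<in> carrier H; c \<in> carrier H; v \<in> carrier N\<rbrakk> \<Longrightarrow> \<phi> (b \<otimes>\<^bsub>H\<^esub> c) v = \<phi> b (\<phi> c v)"
begin

lemma act_closed: "\<lbrakk>b \<in> carrier H; v \<in> carrier N\<rbrakk> \<Longrightarrow> \<phi> b v \<in> carrier N"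
  using act_hom by (auto simp: hom_def)

lemma act_of_mult:
  "\<lbrakk>b \<in> carrier H; v \<in> carrier N; w \<in> carrier N\<rbrakk> \<Longrightarrow> \<phi> b (v \<otimes>\<^bsub>N\<^esub> w) = \<phi> b v \<otimes>\<^bsub>N\<^esub> \<phi> b w"
  using act_hom by (auto simp: hom_def)

lemma act_of_one: "b \<in> carrier H \<Longrightarrow> \<phi> b \<one>\<^bsub>N\<^esub> = \<one>\<^bsub>N\<^esub>"
  using act_hom N.is_group by (blast intro: hom_one)

lemma group_semidirect_product: "group (semidirect_product N H \<phi>)"
proof (rule groupI)
  fix x assume "x \<in> carrier (semidirect_product N H \<phi>)"
  then obtain v b where x: "x = (v, b)" "v \<in> carrier N" "b \<in> carrier H"
    by (auto simp: semidirect_product_def)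
  show "\<exists>y\<in>carrier (semidirect_product N H \<phi>).
      y \<otimes>\<^bsub>semidirect_product N H \<phi>\<^esub> x = \<one>\<^bsub>semidirect_product N H \<phi>\<^esub>"
  proof
    show "(\<phi> (inv\<^bsub>H\<^esub> b) (inv\<^bsub>N\<^esub> v), inv\<^bsub>H\<^esub> b) \<in> carrier (semidirect_product N H \<phi>)"
      using x by (simp add: semidirect_product_def act_closed)
    have "\<phi> (inv\<^bsub>H\<^esub> b) (inv\<^bsub>N\<^esub> v) \<otimes>\<^bsub>N\<^esub> \<phi> (inv\<^bsub>H\<^esub> b) v = \<one>\<^bsub>N\<^esub>"
      using x by (simp add: act_of_one flip: act_of_mult)
    then show "(\<phi> (inv\<^bsub>H\<^esub> b) (inv\<^bsub>N\<^esub> v), inv\<^bsub>H\<^esub> b) \<otimes>\<^bsub>semidirect_product N H \<phi>\<^esub> x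
        = \<one>\<^bsub>semidirect_product N H \<phi>\<^esub>"
      using x by (simp add: semidirect_product_def)
  qed
qed (auto simp: semidirect_product_def act_closed act_one act_mult act_of_mult N.m_assoc H.m_assoc)

end

section \<open>Framed braid groups\<close>

lemma group_braid_group: "group (braid_group n)"
  by (simp add: braid_group_def group_presented_group)

lemma braid_gen_eq: "braid_gen n = gen_class {1..<n} (braid_relations n)"
  by (simp add: fun_eq_iff braid_gen_def gen_class_def)

lemma braid_gen_closed: "i \<in> {1..<n} \<Longrightarrow> braid_gen n i \<in> carrier (braid_group n)"
  by (simp add: braid_gen_eq braid_group_def gen_class_closed)

lemmas braid_group_induct [consumes 1, case_names one gen inv mult] =
  presented_group_induct[of _ "{1..<n}" "braid_relations n" for n, folded braid_group_def braid_gen_eq]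

lemma braid_images_braid_gen: "braid_images (braid_group n) n (braid_gen n)"
proof -
  interpret group "braid_group n" by (rule group_braid_group)
  \<comment> \<open>Peeling off the first letter of a positive word turns both sides of a relation
    into right-nested products of generators, the form demanded by
    \<open>braid_images\<close>.\<close>
  have word: "word_class {1..<n} (braid_relations n) (map (\<lambda>i. (i, True)) (i # js))
      = braid_gen n i \<otimes>\<^bsub>braid_group n\<^esub> word_class {1..<n} (braid_relations n) (map (\<lambda>i. (i, True)) js)"
    if "set (i # js) \<subseteq> {1..<n}" for i js
  proof -
    have "map (\<lambda>i. (i, True)) js \<in> lists ({1..<n} \<times> UNIV)" "[(i, True)] \<in> lists ({1..<n} \<times> UNIV)"
      using that by auto
    from presented_group_mult[OF this(2,1), of "braid_relations n"] show ?thesis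
      by (simp add: braid_gen_def braid_group_def)
  qed
  show ?thesis
  proof
    show "braid_gen n i \<in> carrier (braid_group n)" if "1 \<le> i" "i < n" for i
      using that by (simp add: braid_gen_closed)
    show "braid_gen n i \<otimes>\<^bsub>braid_group n\<^esub> braid_gen n j = braid_gen n j \<otimes>\<^bsub>braid_group n\<^esub> braid_gen n i"
      if "1 \<le> i" "i + 2 \<le> j" "j < n" for i j
    proof -
      have "pres_eq {1..<n} (braid_relations n) [(i, True), (j, True)] [(j, True), (i, True)]"
        using that by (intro pres_eq.relation) (auto simp: braid_relations_def)
      from word_class_eqI[OF this] show ?thesis
        using that word[of i "[j]"] word[of j "[i]"] by (simp add: braid_gen_def)
    qed
    show "braid_gen n i \<otimes>\<^bsub>braid_group n\<^esub> (braid_gen n (i + 1) \<otimes>\<^bsub>braid_group n\<^esub> braid_gen n i)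
        = braid_gen n (i + 1) \<otimes>\<^bsub>braid_group n\<^esub> (braid_gen n i \<otimes>\<^bsub>braid_group n\<^esub> braid_gen n (i + 1))"
      if "1 \<le> i" "i + 1 < n" for i
    proof -
      have "pres_eq {1..<n} (braid_relations n) [(i, True), (i + 1, True), (i, True)]
          [(i + 1, True), (i, True), (i + 1, True)]"
        using that by (intro pres_eq.relation) (auto simp: braid_relations_def)
      from word_class_eqI[OF this] show ?thesis
        using that word[of i "[i + 1, i]"] word[of "i + 1" "[i, i + 1]"]
          word[of i "[i + 1]"] word[of "i + 1" "[i]"] by (simp add: braid_gen_def)
    qed
  qed
qed

section \<open>The full twist and its centrality\<close>

lemma full_twist_eq:
  "full_twist n = braid_images.ascent (braid_group n) (braid_gen n) (n - 1) [^]\<^bsub>braid_group n\<^esub> n"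
  if "n \<ge> 1"
  using that by (simp add: full_twist_def braid_images.ascent_def[OF braid_images_braid_gen])

lemma full_twist_closed: "n \<ge> 1 \<Longrightarrow> full_twist n \<in> carrier (braid_group n)"
  using braid_images.ascent_closed[OF braid_images_braid_gen, of "n - 1" n]
  by (simp add: full_twist_eq group.is_monoid group_braid_group monoid.nat_pow_closed)

lemma full_twist_central:
  assumes "n \<ge> 1" "b \<in> carrier (braid_group n)"
  shows "b \<otimes>\<^bsub>braid_group n\<^esub> full_twist n = full_twist n \<otimes>\<^bsub>braid_group n\<^esub> b"
proof -
  interpret group "braid_group n" by (rule group_braid_group)
  note [simp] = full_twist_closed[OF assms(1)]
  show ?thesis
    using assms(2)
  proof (induction rule: braid_group_induct)
    case (gen s)
    then show ?case
      using braid_images.ascent_power_central[OF braid_images_braid_gen, of s n]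
      by (simp add: full_twist_eq)
  next
    case (inv x)
    then show ?case by (simp add: intertwine_inv(2))
  next
    case (mult x y)
    then show ?case
      by (metis full_twist_closed[OF assms(1)] m_assoc)
  qed simp
qed

lemma normal_full_twist_subgroup: "n \<ge> 1 \<Longrightarrow> normal (full_twist_subgroup n) (braid_group n)"
  unfolding full_twist_subgroup_def
  by (intro group.central_generate group_braid_group full_twist_closed full_twist_central)

section \<open>Permutations underlying braids\<close>

lemma transpose_closed: "i \<in> {1..<n} \<Longrightarrow> transpose i (Suc i) \<in> carrier (sym_group n)"
  by (auto simp: sym_group_carrier intro: permutes_swap_id)

lemma braid_images_transpose: "braid_images (sym_group n) n (\<lambda>i. transpose i (Suc i))"
proof -
  interpret group "sym_group n" by (rule sym_group_is_group)
  show ?thesis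
    by unfold_locales (auto simp: transpose_closed sym_group_mult fun_eq_iff transpose_def)
qed

lemma braid_perm_eq: "braid_perm n = pres_lift (sym_group n) (\<lambda>i. transpose i (Suc i))"
  by (simp add: braid_perm_def)

lemmas sym_group_images = braid_images.presentation_images[OF braid_images_transpose]

lemma braid_perm_hom: "braid_perm n \<in> hom (braid_group n) (sym_group n)"
  unfolding braid_perm_eq braid_group_def
  by (rule presentation_images.pres_lift_hom[OF sym_group_images])

lemma braid_perm_gen: "i \<in> {1..<n} \<Longrightarrow> braid_perm n (braid_gen n i) = transpose i (Suc i)"
  unfolding braid_perm_eq braid_gen_eq
  by (rule presentation_images.pres_lift_gen_class[OF sym_group_images])

lemma group_hom_braid_perm: "group_hom (braid_group n) (sym_group n) (braid_perm n)"
  by (simp add: group_hom_def group_hom_axioms_def group_braid_group sym_group_is_group braid_perm_hom)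

lemma braid_perm_permutes: "b \<in> carrier (braid_group n) \<Longrightarrow> braid_perm n b permutes {1..n}"
  using group_hom.hom_closed[OF group_hom_braid_perm] by (simp only: sym_group_carrier)

text \<open>This is the cycle on 1, ..., m + 1. Products in the symmetric group apply their last
  factor first, so the induction evaluates the new transposition before the shorter cycle.\<close>

lemma ascent_transpose:
  assumes "m < n" "1 \<le> j"
  shows "braid_images.ascent (sym_group n) (\<lambda>i. transpose i (Suc i)) m j
    = (if j \<le> m then Suc j else if j = Suc m then 1 else j)"
proof -
  interpret braid_images "sym_group n" n "\<lambda>i. transpose i (Suc i)"
    by (rule braid_images_transpose)
  show ?thesis
    using assms
  proof (induction m arbitrary: j)
    case 0
    then show ?case by (simp only: ascent_0 sym_group_one) simp
  next
    case (Suc m)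
    have "ascent (Suc m) j = ascent m (transpose (Suc m) (Suc (Suc m)) j)"
      using Suc.prems by (simp add: ascent_Suc sym_group_mult)
    also have "\<dots> = (let k = transpose (Suc m) (Suc (Suc m)) j in
        if k \<le> m then Suc k else if k = Suc m then 1 else k)"
      using Suc.prems unfolding Let_def by (intro Suc.IH) (auto simp: transpose_def)
    also have "\<dots> = (if j \<le> Suc m then Suc j else if j = Suc (Suc m) then 1 else j)"
      by (auto simp: transpose_def)
    finally show ?case .
  qed
qed

text \<open>The permutation is the n-th power of an n-cycle. Its triviality makes the full twist act
  trivially on framings, one half of the centrality of the framed full twist.\<close>

lemma braid_perm_full_twist:
  assumes "n \<ge> 1"
  shows "braid_perm n (full_twist n) = id"
proof -
  interpret S: braid_images "sym_group n" n "\<lambda>i. transpose i (Suc i)"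
    by (rule braid_images_transpose)
  interpret B: braid_images "braid_group n" n "braid_gen n"
    by (rule braid_images_braid_gen)
  interpret hom: group_hom "braid_group n" "sym_group n" "braid_perm n"
    by (rule group_hom_braid_perm)
  define c where "c = S.ascent (n - 1)"
  have "braid_perm n (B.ascent (n - 1)) = c"
    using assms unfolding B.ascent_def S.ascent_def c_def
    by (subst hom.hom_list_mult) (auto simp: braid_gen_closed braid_perm_gen
        intro!: arg_cong[where f = "list_mult (sym_group n)"])
  then have perm: "braid_perm n (full_twist n) = c [^]\<^bsub>sym_group n\<^esub> n"
    using assms by (simp add: full_twist_eq hom.hom_nat_pow)
  have cyc: "c j = (if j < n then Suc j else 1)" if "j \<in> {1..n}" for j
    using that assms ascent_transpose[of "n - 1" n j] by (auto simp: c_def)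
  \<comment> \<open>For \<open>k \<le> n\<close> the index wraps around at most once, so a single
    subtraction of \<open>n\<close> describes the power.\<close>
  have pow: "(c [^]\<^bsub>sym_group n\<^esub> k) j = (if j + k \<le> n then j + k else j + k - n)"
    if "j \<in> {1..n}" "k \<le> n" for j k
    using that
  proof (induction k arbitrary: j)
    case 0
    then show ?case by (simp add: sym_group_one)
  next
    case (Suc k)
    have "(c [^]\<^bsub>sym_group n\<^esub> Suc k) j = (c [^]\<^bsub>sym_group n\<^esub> k) (c j)"
      by (simp add: sym_group_mult)
    then show ?case
      using Suc.prems cyc[of j] Suc.IH[of "c j"] by auto
  qed
  have "braid_perm n (full_twist n) j = j" for j
  proof (cases "j \<in> {1..n}")
    case True
    then show ?thesis using pow[of j n] by (simp add: perm)
  next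
    case False
    then show ?thesis
      using braid_perm_permutes[OF full_twist_closed[OF assms]] by (rule permutes_not_in[rotated])
  qed
  then show ?thesis by (simp add: fun_eq_iff)
qed

section \<open>The framing lattice, the permutation action and the framed full twist\<close>

lemma group_framing_lattice: "group (framing_lattice n)"
  by (simp add: framing_lattice_def)

lemma framing_lattice_carrier: "carrier (framing_lattice n) = {1..n} \<rightarrow>\<^sub>E UNIV"
  by (simp add: framing_lattice_def)

lemma framing_lattice_mult: "v \<otimes>\<^bsub>framing_lattice n\<^esub> w = (\<lambda>i\<in>{1..n}. v i + w i)"
  by (simp add: framing_lattice_def)

lemma framing_lattice_one: "\<one>\<^bsub>framing_lattice n\<^esub> = (\<lambda>i\<in>{1..n}. 0)"
  by (simp add: framing_lattice_def)

lemma permute_lattice_apply: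
  "\<lbrakk>p permutes {1..n}; i \<in> {1..n}\<rbrakk> \<Longrightarrow> permute_lattice n p v i = v (inv' p i)"
  by (simp add: permute_lattice_def sym_group_carrier)

lemma permute_lattice_closed: "permute_lattice n p v \<in> carrier (framing_lattice n)"
  by (simp add: permute_lattice_def framing_lattice_carrier)

text \<open>A vector is pulled back along the inverse permutation. Inversion and pullback both
  reverse composition, so together they give a left action.\<close>

lemma framed_braid_action:
  "group_automorphism_action (framing_lattice n) (braid_group n) (\<lambda>b. permute_lattice n (braid_perm n b))"
proof -
  interpret hom: group_hom "braid_group n" "sym_group n" "braid_perm n"
    by (rule group_hom_braid_perm)
  \<comment> \<open>Lattice vectors are extensional functions, hence determined by their coordinates
    in \<open>{1..n}\<close>.\<close>
  have ext: "v = w" if "v \<in> carrier (framing_lattice n)" "w \<in> carrier (framing_lattice n)"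
    "\<And>i. i \<in> {1..n} \<Longrightarrow> v i = w i" for v w
    using that unfolding framing_lattice_carrier by (rule PiE_ext)
  have mult_closed: "v \<otimes>\<^bsub>framing_lattice n\<^esub> w \<in> carrier (framing_lattice n)" for v w
    by (simp add: framing_lattice_carrier framing_lattice_mult)
  note perm = braid_perm_permutes
  note inv_in = permutes_in_image[OF permutes_inv[OF perm]]
  show ?thesis
  proof (intro group_automorphism_action.intro group_automorphism_action_axioms.intro
      group_framing_lattice group_braid_group homI)
    fix b assume b: "b \<in> carrier (braid_group n)"
    show "permute_lattice n (braid_perm n b) (v \<otimes>\<^bsub>framing_lattice n\<^esub> w)
        = permute_lattice n (braid_perm n b) v \<otimes>\<^bsub>framing_lattice n\<^esub> permute_lattice n (braid_perm n b) w"
      for v w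
      using perm[OF b] inv_in[OF b]
      by (intro ext permute_lattice_closed mult_closed)
        (simp add: permute_lattice_apply framing_lattice_mult del: atLeastAtMost_iff)
    fix c v assume c: "c \<in> carrier (braid_group n)"
    have "inv' (braid_perm n b \<circ> braid_perm n c) = inv' (braid_perm n c) \<circ> inv' (braid_perm n b)"
      using perm[OF b] perm[OF c] by (intro o_inv_distrib) (auto simp: permutes_bij)
    then show "permute_lattice n (braid_perm n (b \<otimes>\<^bsub>braid_group n\<^esub> c)) v
        = permute_lattice n (braid_perm n b) (permute_lattice n (braid_perm n c) v)"
      using perm[OF b] perm[OF c] inv_in[OF b] permutes_compose[OF perm[OF c] perm[OF b]] b c
      by (intro ext permute_lattice_closed)
        (simp add: permute_lattice_apply sym_group_mult del: atLeastAtMost_iff)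
  next
    show "permute_lattice n (braid_perm n \<one>\<^bsub>braid_group n\<^esub>) v = v"
      if "v \<in> carrier (framing_lattice n)" for v
      using that by (intro ext permute_lattice_closed)
        (simp_all add: permute_lattice_apply sym_group_one)
  qed (rule permute_lattice_closed)
qed

lemma group_framed_braid_group: "group (framed_braid_group n)"
  unfolding framed_braid_group_def
  by (rule group_automorphism_action.group_semidirect_product[OF framed_braid_action])

lemma framed_braid_group_carrier:
  "carrier (framed_braid_group n) = carrier (framing_lattice n) \<times> carrier (braid_group n)"
  by (simp add: framed_braid_group_def semidirect_product_def)

lemma framed_braid_group_mult:
  "(v, b) \<otimes>\<^bsub>framed_braid_group n\<^esub> (w, c) =
    (v \<otimes>\<^bsub>framing_lattice n\<^esub> permute_lattice n (braid_perm n b) w, b \<otimes>\<^bsub>braid_group n\<^esub> c)"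
  by (simp add: framed_braid_group_def semidirect_product_def)

lemma snd_hom: "snd \<in> hom (framed_braid_group n) (braid_group n)"
  by (rule homI) (auto simp: framed_braid_group_carrier framed_braid_group_mult)

text \<open>The closed form of the product that generates \<open>framed_full_twist_subgroup\<close>;
  \<open>framed_full_twist_eq\<close> identifies the two.\<close>

definition framed_full_twist :: "nat \<Rightarrow> (nat \<Rightarrow> int) \<times> nat gen_word set"
  where "framed_full_twist n = (\<lambda>i\<in>{1..n}. 1, full_twist n)"

text \<open>Partial products are needed for the induction; the case \<open>m = n\<close> is the
  goal. Framing generators have trivial braid part, so they do not permute one another and the
  vectors simply add.\<close>

lemma framing_gen_product:
  "m \<le> n \<Longrightarrow> list_mult (framed_braid_group n) (map (framing_gen n) [1..<m + 1])
    = (\<lambda>j\<in>{1..n}. if j \<le> m then 1 else 0, \<one>\<^bsub>braid_group n\<^esub>)"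
proof (induction m)
  case 0
  then show ?case
    by (simp add: list_mult_def framed_braid_group_def semidirect_product_def framing_lattice_one
        restrict_def fun_eq_iff)
next
  case (Suc m)
  interpret B: group "braid_group n" by (rule group_braid_group)
  interpret act: group_automorphism_action "framing_lattice n" "braid_group n"
    "\<lambda>b. permute_lattice n (braid_perm n b)" by (rule framed_braid_action)
  interpret BF: group "framed_braid_group n" by (rule group_framed_braid_group)
  define d :: "nat \<Rightarrow> int" where "d = (\<lambda>j\<in>{1..n}. if j = m + 1 then 1 else 0)"
  have closed: "framing_gen n i \<in> carrier (framed_braid_group n)" for i
    by (simp add: framing_gen_def framed_braid_group_carrier framing_lattice_carrier)
  have "map (framing_gen n) [1..<Suc m + 1] = map (framing_gen n) [1..<m + 1] @ [framing_gen n (m + 1)]"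
    by simp
  moreover have "list_mult (framed_braid_group n) (map (framing_gen n) [1..<m + 1] @ [framing_gen n (m + 1)])
      = list_mult (framed_braid_group n) (map (framing_gen n) [1..<m + 1])
        \<otimes>\<^bsub>framed_braid_group n\<^esub> framing_gen n (m + 1)"
    using closed by (intro BF.list_mult_snoc) auto
  moreover have "framing_gen n (m + 1) = (d, \<one>\<^bsub>braid_group n\<^esub>)"
    by (simp add: framing_gen_def d_def)
  moreover have "permute_lattice n (braid_perm n \<one>\<^bsub>braid_group n\<^esub>) d = d"
    by (rule act.act_one) (simp add: d_def framing_lattice_carrier)
  moreover have "(\<lambda>j\<in>{1..n}. if j \<le> m then 1 else 0) \<otimes>\<^bsub>framing_lattice n\<^esub> d
      = (\<lambda>j\<in>{1..n}. if j \<le> Suc m then 1 else 0)"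
    by (auto simp: framing_lattice_mult d_def fun_eq_iff)
  ultimately show ?case
    using Suc by (simp only: framed_braid_group_mult Suc_leD B.l_one B.one_closed)
qed

lemma framed_full_twist_eq:
  assumes "n \<ge> 1"
  shows "list_mult (framed_braid_group n) (map (framing_gen n) [1..<n + 1])
    \<otimes>\<^bsub>framed_braid_group n\<^esub> framed_braid n (full_twist n) = framed_full_twist n"
proof -
  interpret B: group "braid_group n" by (rule group_braid_group)
  interpret L: group "framing_lattice n" by (rule group_framing_lattice)
  interpret act: group_automorphism_action "framing_lattice n" "braid_group n"
    "\<lambda>b. permute_lattice n (braid_perm n b)" by (rule framed_braid_action)
  have "(\<lambda>j\<in>{1..n}. if j \<le> n then 1 else 0 :: int) = (\<lambda>j\<in>{1..n}. 1)"
    by (auto simp: fun_eq_iff)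
  moreover have "(\<lambda>j\<in>{1..n}. 1 :: int) \<in> carrier (framing_lattice n)"
    by (simp add: framing_lattice_carrier)
  ultimately show ?thesis
    unfolding framing_gen_product[OF order.refl]
    using full_twist_closed[OF assms]
    by (simp only: framed_full_twist_def framed_braid_def framed_braid_group_mult
        act.act_one[OF L.one_closed] L.r_one B.l_one)
qed

lemma framed_full_twist_subgroup_eq:
  "n \<ge> 1 \<Longrightarrow> framed_full_twist_subgroup n = generate (framed_braid_group n) {framed_full_twist n}"
  by (simp only: framed_full_twist_subgroup_def framed_full_twist_eq)

lemma framed_full_twist_closed:
  "n \<ge> 1 \<Longrightarrow> framed_full_twist n \<in> carrier (framed_braid_group n)"
  by (simp add: framed_full_twist_def framed_braid_group_carrier framing_lattice_carrier full_twist_closed)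

text \<open>The constant vector is fixed by every permutation, the full twist acts trivially on
  vectors because its permutation is the identity, and it is central among braids. These settle the
  two cross terms and the braid component.\<close>

lemma framed_full_twist_central:
  assumes "n \<ge> 1" "x \<in> carrier (framed_braid_group n)"
  shows "x \<otimes>\<^bsub>framed_braid_group n\<^esub> framed_full_twist n = framed_full_twist n \<otimes>\<^bsub>framed_braid_group n\<^esub> x"
proof -
  interpret hom: group_hom "braid_group n" "sym_group n" "braid_perm n"
    by (rule group_hom_braid_perm)
  interpret act: group_automorphism_action "framing_lattice n" "braid_group n"
    "\<lambda>b. permute_lattice n (braid_perm n b)" by (rule framed_braid_action)
  obtain v b where x: "x = (v, b)" "v \<in> carrier (framing_lattice n)" "b \<in> carrier (braid_group n)"
    using assms(2) by (auto simp: framed_braid_group_carrier)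
  have "inv' (braid_perm n b) i \<in> {1..n}" if "i \<in> {1..n}" for i
    using that permutes_in_image[OF permutes_inv[OF braid_perm_permutes[OF x(3)]]] by blast
  then have "permute_lattice n (braid_perm n b) (\<lambda>i\<in>{1..n}. 1) = (\<lambda>i\<in>{1..n}. 1)"
    using braid_perm_permutes[OF x(3)]
    by (auto simp: permute_lattice_def sym_group_carrier fun_eq_iff)
  moreover have "permute_lattice n (braid_perm n (full_twist n)) v = v"
    using act.act_one[OF x(2)] by (simp add: braid_perm_full_twist[OF assms(1)] sym_group_one)
  ultimately show ?thesis
    using full_twist_central[OF assms(1) x(3)]
    by (auto simp: x(1) framed_full_twist_def framed_braid_group_mult framing_lattice_mult fun_eq_iff
        add.commute)
qed

lemma normal_framed_full_twist_subgroup: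
  "n \<ge> 1 \<Longrightarrow> normal (framed_full_twist_subgroup n) (framed_braid_group n)"
  unfolding framed_full_twist_subgroup_eq
  by (intro group.central_generate group_framed_braid_group framed_full_twist_closed framed_full_twist_central)

lemma snd_framed_full_twist_subgroup:
  assumes "n \<ge> 1"
  shows "snd ` framed_full_twist_subgroup n = full_twist_subgroup n"
proof -
  interpret group_hom "framed_braid_group n" "braid_group n" snd
    by (simp add: group_hom_def group_hom_axioms_def group_braid_group group_framed_braid_group snd_hom)
  show ?thesis
    using generate_img[of "{framed_full_twist n}"] framed_full_twist_closed[OF assms]
    by (simp add: framed_full_twist_subgroup_eq[OF assms] full_twist_subgroup_def framed_full_twist_def)
qed

section \<open>Representations of framed braid groups\<close>

text \<open>The relations under which images of the crossings and of the framings extend to the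
  semidirect product: \<open>framing_move\<close> is equivariance for a single crossing.\<close>

locale framed_braid_images = braid_images G N f
  for G :: "('a, 'e) monoid_scheme" (structure) and N f +
  fixes t :: "nat \<Rightarrow> 'a"
  assumes framing_closed: "\<lbrakk>1 \<le> i; i \<le> N\<rbrakk> \<Longrightarrow> t i \<in> carrier G"
    and framing_comm: "\<lbrakk>1 \<le> i; i < j; j \<le> N\<rbrakk> \<Longrightarrow> t i \<otimes> t j = t j \<otimes> t i"
    and framing_move: "\<lbrakk>1 \<le> i; i < N; 1 \<le> j; j \<le> N\<rbrakk> \<Longrightarrow> f i \<otimes> t j = t (transpose i (Suc i) j) \<otimes> f i"
begin

definition lattice_rep :: "(nat \<Rightarrow> int) \<Rightarrow> 'a"
  where "lattice_rep v = list_mult G (map (\<lambda>i. t i [^] v i) [1..<N + 1])"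

definition framed_rep :: "(nat \<Rightarrow> int) \<times> nat gen_word set \<Rightarrow> 'a"
  where "framed_rep = (\<lambda>(v, b). lattice_rep v \<otimes> pres_lift G f b)"

lemma int_pow_intertwine:
  assumes "g \<in> carrier G" "x \<in> carrier G" "y \<in> carrier G" "g \<otimes> x = y \<otimes> g"
  shows "g \<otimes> x [^] (k :: int) = y [^] k \<otimes> g"
proof -
  have nat: "g \<otimes> x [^] m = y [^] m \<otimes> g" for m :: nat
  proof (induction m)
    case (Suc m)
    then show ?case
      using assms by (metis m_assoc nat_pow_Suc nat_pow_closed)
  qed (use assms in simp)
  have "g \<otimes> inv (x [^] m) = inv (y [^] m) \<otimes> g" for m :: nat
    using nat[of m] assms(1-3) by (simp add: intertwine_inv(1))
  then show ?thesis
    unfolding int_pow_def2 by (cases "k < 0") (simp_all only: if_True if_False nat)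
qed

lemma framing_commute:
  "\<lbrakk>1 \<le> i; i \<le> N; 1 \<le> j; j \<le> N\<rbrakk> \<Longrightarrow> t i \<otimes> t j = t j \<otimes> t i"
  using framing_comm[of i j] framing_comm[of j i] by (cases i j rule: linorder_cases) auto

lemma framing_power_commute:
  assumes "1 \<le> i" "i \<le> N" "1 \<le> j" "j \<le> N"
  shows "t i [^] (k :: int) \<otimes> t j [^] (l :: int) = t j [^] l \<otimes> t i [^] k"
  using assms by (intro int_pow_intertwine int_pow_intertwine[symmetric])
    (auto simp: framing_closed intro: framing_commute)

lemma lattice_rep_closed: "lattice_rep v \<in> carrier G"
  unfolding lattice_rep_def by (intro list_mult_closed) (auto simp: framing_closed)

lemma lattice_rep_mult: "lattice_rep (v \<otimes>\<^bsub>framing_lattice N\<^esub> w) = lattice_rep v \<otimes> lattice_rep w"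
proof -
  have "map (\<lambda>i. t i [^] (v \<otimes>\<^bsub>framing_lattice N\<^esub> w) i) [1..<N + 1]
      = map (\<lambda>i. t i [^] v i \<otimes> t i [^] w i) [1..<N + 1]"
    by (auto simp: framing_lattice_mult framing_closed int_pow_mult)
  then show ?thesis
    unfolding lattice_rep_def
    by (simp only:) (intro list_mult_mult, auto simp: framing_closed framing_power_commute)
qed

sublocale lift: presentation_images G "{1..<N}" "braid_relations N" f
  by (rule presentation_images)

lemma pres_lift_hom_braid: "pres_lift G f \<in> hom (braid_group N) G"
  unfolding braid_group_def by (rule lift.pres_lift_hom)

lemma pres_lift_braid_gen: "i \<in> {1..<N} \<Longrightarrow> pres_lift G f (braid_gen N i) = f i"
  unfolding braid_gen_eq by (rule lift.pres_lift_gen_class)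

sublocale lift: group_hom "braid_group N" G "pres_lift G f"
  by (simp add: group_hom_def group_hom_axioms_def group_braid_group pres_lift_hom_braid is_group)

text \<open>Passing \<open>f i\<close> through the product renames each \<open>t j\<close> to
  \<open>t (p j)\<close> while its exponent stays put. Read in the new indices, the exponents form
  the permuted vector, but the factors stand in the order p 1, ..., p N; commutativity of the
  framings sorts them.\<close>

lemma gen_lattice_rep:
  assumes "i \<in> {1..<N}"
  shows "f i \<otimes> lattice_rep v = lattice_rep (permute_lattice N (transpose i (Suc i)) v) \<otimes> f i"
proof -
  define p where "p = transpose i (Suc i)"
  have p: "p permutes {1..N}"
    using transpose_closed[OF assms] by (simp add: p_def sym_group_carrier)
  let ?w = "permute_lattice N p v"
  have p_in: "p j \<in> {1..N}" if "j \<in> {1..N}" for j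
    using that permutes_in_image[OF p] by blast
  have w: "?w (p j) = v j" if "j \<in> {1..N}" for j
    using that p_in[OF that] by (simp add: permute_lattice_apply[OF p] permutes_inverses[OF p] del: atLeastAtMost_iff)
  have "f i \<otimes> lattice_rep v = list_mult G (map (\<lambda>j. t (p j) [^] v j) [1..<N + 1]) \<otimes> f i"
    unfolding lattice_rep_def
  proof (rule list_mult_intertwine)
    fix j assume "j \<in> set [1..<N + 1]"
    then have j: "j \<in> {1..N}" by auto
    show "f i \<otimes> t j [^] v j = t (p j) [^] v j \<otimes> f i"
      using assms j p_in[OF j] framing_move[of i j]
      by (intro int_pow_intertwine) (auto simp: framing_closed gen_closed p_def)
  qed (use assms p_in in \<open>auto simp: framing_closed gen_closed\<close>)
  also have "map (\<lambda>j. t (p j) [^] v j) [1..<N + 1] = map (\<lambda>j. t j [^] ?w j) (map p [1..<N + 1])"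
    unfolding map_map by (rule map_cong) (auto simp: w)
  also have "list_mult G \<dots> = lattice_rep ?w"
    unfolding lattice_rep_def
  proof (rule list_mult_permute)
    have "set [1..<N + 1] = {1..N}"
      by auto
    then have "set (map p [1..<N + 1]) = set [1..<N + 1]"
      by (simp only: set_map permutes_image[OF p])
    moreover have "distinct (map p [1..<N + 1])"
      using permutes_inj[OF p] by (simp add: distinct_map inj_on_subset)
    ultimately show "mset (map p [1..<N + 1]) = mset [1..<N + 1]"
      by (metis distinct_upt set_eq_iff_mset_eq_distinct)
    have mem: "1 \<le> j" "j \<le> N" if "j \<in> set (map p [1..<N + 1])" for j
    proof -
      have "j \<in> p ` {1..N}"
        using that by auto
      then show "1 \<le> j" "j \<le> N"
        unfolding permutes_image[OF p] by auto
    qed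
    then show "t j [^] ?w j \<in> carrier G" if "j \<in> set (map p [1..<N + 1])" for j
      using that by (simp only: framing_closed int_pow_closed)
    show "t j [^] ?w j \<otimes> t k [^] ?w k = t k [^] ?w k \<otimes> t j [^] ?w j"
      if "j \<in> set (map p [1..<N + 1])" "k \<in> set (map p [1..<N + 1])" for j k
      using mem[OF that(1)] mem[OF that(2)] by (rule framing_power_commute)
  qed
  finally show ?thesis by (simp add: p_def)
qed

text \<open>Equivariance spreads from generators to all braids. The vector varies in the induction:
  for an inverse the hypothesis is applied to the vector already moved by that inverse, for a
  product to the vector moved by the right factor.\<close>

lemma lift_lattice_rep:
  assumes "b \<in> carrier (braid_group N)" "v \<in> carrier (framing_lattice N)"
  shows "pres_lift G f b \<otimes> lattice_rep v = lattice_rep (permute_lattice N (braid_perm N b) v) \<otimes> pres_lift G f b"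
proof -
  interpret act: group_automorphism_action "framing_lattice N" "braid_group N"
    "\<lambda>b. permute_lattice N (braid_perm N b)" by (rule framed_braid_action)
  note closed = lattice_rep_closed lift.hom_closed
  show ?thesis
    using assms
  proof (induction arbitrary: v rule: braid_group_induct)
    case one
    then show ?case
      by (simp add: act.act_one lattice_rep_closed del: hom_one)
  next
    case (gen s)
    then show ?case
      using gen_lattice_rep[of s v] by (simp add: pres_lift_braid_gen braid_perm_gen)
  next
    case (inv x)
    let ?w = "permute_lattice N (braid_perm N (inv\<^bsub>braid_group N\<^esub> x)) v"
    have "permute_lattice N (braid_perm N x) ?w = v"
      using inv act.act_one by (simp flip: act.act_mult)
    then have "pres_lift G f x \<otimes> lattice_rep ?w = lattice_rep v \<otimes> pres_lift G f x"
      using inv by (simp add: permute_lattice_closed)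
    then show ?case
      using inv.hyps lift.hom_closed lattice_rep_closed by (simp add: intertwine_inv(2))
  next
    case (mult x y)
    let ?w = "permute_lattice N (braid_perm N y) v"
    have "pres_lift G f (x \<otimes>\<^bsub>braid_group N\<^esub> y) \<otimes> lattice_rep v
        = (pres_lift G f x \<otimes> lattice_rep ?w) \<otimes> pres_lift G f y"
      using mult closed by (simp add: m_assoc)
    also have "pres_lift G f x \<otimes> lattice_rep ?w
        = lattice_rep (permute_lattice N (braid_perm N x) ?w) \<otimes> pres_lift G f x"
      by (intro mult.IH permute_lattice_closed)
    finally show ?case
      using mult.hyps mult.prems closed by (simp add: act.act_mult m_assoc)
  qed
qed

text \<open>In a semidirect product the second vector enters moved by the first braid;
  \<open>lift_lattice_rep\<close> says that moving the image of the braid past the image of the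
  vector has exactly this effect.\<close>

theorem framed_rep_hom: "framed_rep \<in> hom (framed_braid_group N) G"
proof (rule homI)
  fix x assume "x \<in> carrier (framed_braid_group N)"
  then obtain v b where x: "x = (v, b)" "v \<in> carrier (framing_lattice N)" "b \<in> carrier (braid_group N)"
    by (auto simp: framed_braid_group_carrier)
  then show "framed_rep x \<in> carrier G"
    by (simp add: framed_rep_def lattice_rep_closed)
  fix y assume "y \<in> carrier (framed_braid_group N)"
  then obtain w c where y: "y = (w, c)" "w \<in> carrier (framing_lattice N)" "c \<in> carrier (braid_group N)"
    by (auto simp: framed_braid_group_carrier)
  note closed = lattice_rep_closed lift.hom_closed[OF x(3)] lift.hom_closed[OF y(3)]
  have "framed_rep (x \<otimes>\<^bsub>framed_braid_group N\<^esub> y) = lattice_rep v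
      \<otimes> (lattice_rep (permute_lattice N (braid_perm N b) w) \<otimes> pres_lift G f b) \<otimes> pres_lift G f c"
    using x y closed by (simp add: framed_rep_def framed_braid_group_mult lattice_rep_mult m_assoc)
  also have "\<dots> = framed_rep x \<otimes> framed_rep y"
    using x y closed by (simp add: framed_rep_def m_assoc flip: lift_lattice_rep)
  finally show "framed_rep (x \<otimes>\<^bsub>framed_braid_group N\<^esub> y) = framed_rep x \<otimes> framed_rep y" .
qed

lemma lattice_rep_unit:
  assumes "i \<in> {1..N}"
  shows "lattice_rep (\<lambda>j\<in>{1..N}. if j = i then 1 else 0) = t i"
proof -
  have split: "[1..<N + 1] = [1..<i] @ i # [Suc i..<N + 1]"
    using assms upt_add_eq_append[of 1 i "N + 1 - i"] upt_conv_Cons[of i "N + 1"] by simp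
  let ?u = "\<lambda>j. t j [^] (\<lambda>j\<in>{1..N}. if j = i then 1 else 0 :: int) j"
  have one: "list_mult G (map ?u [1..<i]) = \<one>" "list_mult G (map ?u [Suc i..<N + 1]) = \<one>"
    using assms by (auto intro!: list_mult_one)
  have closed: "set (map ?u [1..<i]) \<subseteq> carrier G" "set (map ?u [Suc i..<N + 1]) \<subseteq> carrier G"
      "?u i = t i" "t i \<in> carrier G"
    using assms by (auto simp: framing_closed)
  have "lattice_rep (\<lambda>j\<in>{1..N}. if j = i then 1 else 0)
      = list_mult G (map ?u [1..<i] @ t i # map ?u [Suc i..<N + 1])"
    unfolding lattice_rep_def split using closed(3) by simp
  then show ?thesis
    using one closed by (simp add: list_mult_append list_mult_Cons del: map_append)
qed

lemma framed_rep_framing_gen: "i \<in> {1..N} \<Longrightarrow> framed_rep (framing_gen N i) = t i"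
  using lattice_rep_unit[of i] by (simp add: framed_rep_def framing_gen_def framing_closed del: restrict_apply)

lemma framed_rep_braid_gen: "i \<in> {1..<N} \<Longrightarrow> framed_rep (framed_braid N (braid_gen N i)) = f i"
proof -
  assume i: "i \<in> {1..<N}"
  have "lattice_rep \<one>\<^bsub>framing_lattice N\<^esub> = \<one>"
    unfolding lattice_rep_def by (rule list_mult_one) (auto simp: framing_lattice_one)
  then show ?thesis
    using i by (simp add: framed_rep_def framed_braid_def pres_lift_braid_gen gen_closed)
qed

lemma framed_rep_full_twist:
  assumes "N \<ge> 1"
  shows "framed_rep (framed_full_twist N) = list_mult G (map t [1..<N + 1]) \<otimes> ascent (N - 1) [^] N"
proof -
  interpret B: braid_images "braid_group N" N "braid_gen N"
    by (rule braid_images_braid_gen)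
  have "pres_lift G f (B.ascent (N - 1)) = ascent (N - 1)"
    using assms unfolding B.ascent_def ascent_def
    by (subst lift.hom_list_mult) (auto simp: braid_gen_closed pres_lift_braid_gen
        intro!: arg_cong[where f = "list_mult G"])
  then have "pres_lift G f (full_twist N) = ascent (N - 1) [^] N"
    using assms by (simp add: full_twist_eq lift.hom_nat_pow)
  moreover have "lattice_rep (\<lambda>i\<in>{1..N}. 1) = list_mult G (map t [1..<N + 1])"
    unfolding lattice_rep_def by (intro arg_cong[where f = "list_mult G"]) (auto simp: framing_closed)
  ultimately show ?thesis
    by (simp add: framed_rep_def framed_full_twist_def)
qed

end

text \<open>An injective homomorphism reflects relations. With conjugation by
  \<open>left_nest\<close> this carries the relations from the left-nested power to every
  parenthesization.\<close>

lemma framed_braid_images_pullback: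
  assumes hom: "group_hom G H h" and inj: "inj_on h (carrier G)"
    and H: "framed_braid_images H N f' t'"
    and f: "\<And>i. \<lbrakk>1 \<le> i; i < N\<rbrakk> \<Longrightarrow> f i \<in> carrier G" "\<And>i. \<lbrakk>1 \<le> i; i < N\<rbrakk> \<Longrightarrow> h (f i) = f' i"
    and t: "\<And>i. \<lbrakk>1 \<le> i; i \<le> N\<rbrakk> \<Longrightarrow> t i \<in> carrier G" "\<And>i. \<lbrakk>1 \<le> i; i \<le> N\<rbrakk> \<Longrightarrow> h (t i) = t' i"
  shows "framed_braid_images G N f t"
proof -
  interpret group_hom G H h by (rule hom)
  interpret H: framed_braid_images H N f' t' by (rule H)
  have eq: "x = y" if "x \<in> carrier G" "y \<in> carrier G" "h x = h y" for x y
    using that inj by (auto simp: inj_on_def)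
  show ?thesis
  proof
    show "f i \<otimes>\<^bsub>G\<^esub> f j = f j \<otimes>\<^bsub>G\<^esub> f i" if "1 \<le> i" "i + 2 \<le> j" "j < N" for i j
      using that f H.far[of i j] by (intro eq) auto
    show "f i \<otimes>\<^bsub>G\<^esub> (f (i + 1) \<otimes>\<^bsub>G\<^esub> f i) = f (i + 1) \<otimes>\<^bsub>G\<^esub> (f i \<otimes>\<^bsub>G\<^esub> f (i + 1))" if "1 \<le> i" "i + 1 < N" for i
      using that f H.near[of i] by (intro eq) auto
    show "t i \<otimes>\<^bsub>G\<^esub> t j = t j \<otimes>\<^bsub>G\<^esub> t i" if "1 \<le> i" "i < j" "j \<le> N" for i j
      using that t H.framing_comm[of i j] by (intro eq) auto
    show "f i \<otimes>\<^bsub>G\<^esub> t j = t (transpose i (Suc i) j) \<otimes>\<^bsub>G\<^esub> f i" if "1 \<le> i" "i < N" "1 \<le> j" "j \<le> N" for i j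
    proof -
      have "1 \<le> transpose i (Suc i) j" "transpose i (Suc i) j \<le> N"
        using that by (auto simp: transpose_def)
      then show ?thesis
        using that f t H.framing_move[of i j] by (intro eq) auto
    qed
  qed (use f t in auto)
qed

text \<open>The framed full twist is a word in the generators, so a homomorphism matching generators
  matches these words too. This lets the full twist be computed on the left-nested power.\<close>

lemma full_twist_image:
  assumes hom: "group_hom G H h" and H: "framed_braid_images H N f' t'" and G: "framed_braid_images G N f t"
    and "N \<ge> 1" and f: "\<And>i. \<lbrakk>1 \<le> i; i < N\<rbrakk> \<Longrightarrow> h (f i) = f' i"
    and t: "\<And>i. \<lbrakk>1 \<le> i; i \<le> N\<rbrakk> \<Longrightarrow> h (t i) = t' i"
  shows "h (list_mult G (map t [1..<N + 1]) \<otimes>\<^bsub>G\<^esub> braid_images.ascent G f (N - 1) [^]\<^bsub>G\<^esub> N)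
    = list_mult H (map t' [1..<N + 1]) \<otimes>\<^bsub>H\<^esub> braid_images.ascent H f' (N - 1) [^]\<^bsub>H\<^esub> N"
proof -
  interpret group_hom G H h by (rule hom)
  interpret H: framed_braid_images H N f' t' by (rule H)
  interpret G: framed_braid_images G N f t by (rule G)
  have twists: "set (map t [1..<N + 1]) \<subseteq> carrier G" "map h (map t [1..<N + 1]) = map t' [1..<N + 1]"
    using t G.framing_closed by auto
  have braids: "set (map f [1..<Suc (N - 1)]) \<subseteq> carrier G" "map h (map f [1..<Suc (N - 1)]) = map f' [1..<Suc (N - 1)]"
    using f G.gen_closed by auto
  have "h (G.ascent (N - 1)) = H.ascent (N - 1)"
    unfolding G.ascent_def H.ascent_def by (simp only: hom_list_mult[OF braids(1)] braids(2))
  moreover have "h (list_mult G (map t [1..<N + 1])) = list_mult H (map t' [1..<N + 1])"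
    by (simp only: hom_list_mult[OF twists(1)] twists(2))
  moreover have "list_mult G (map t [1..<N + 1]) \<in> carrier G"
    by (rule G.list_mult_closed[OF twists(1)])
  moreover have "G.ascent (N - 1) \<in> carrier G"
    using \<open>N \<ge> 1\<close> by simp
  ultimately show ?thesis
    by (simp only: hom_mult G.nat_pow_closed hom_nat_pow)
qed

section \<open>Categories\<close>

context category
begin

lemma in_homI: "\<lbrakk>f \<in> Arr C; Dom C f = X; Cod C f = Y\<rbrakk> \<Longrightarrow> f \<in> Hom C X Y"
  by (simp add: Hom_def)

lemma homD: "f \<in> Hom C X Y \<Longrightarrow> f \<in> Arr C" "f \<in> Hom C X Y \<Longrightarrow> Dom C f = X" "f \<in> Hom C X Y \<Longrightarrow> Cod C f = Y"
  by (simp_all add: Hom_def)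

lemma arr_hom: "f \<in> Arr C \<Longrightarrow> f \<in> Hom C (Dom C f) (Cod C f)"
  by (simp add: Hom_def)

lemmas obj_closed [simp] = dom_closed cod_closed

lemma ident_simps [simp]:
  "X \<in> Obj C \<Longrightarrow> Ident C X \<in> Arr C"
  "X \<in> Obj C \<Longrightarrow> Dom C (Ident C X) = X"
  "X \<in> Obj C \<Longrightarrow> Cod C (Ident C X) = X"
  using id_hom by (auto simp: Hom_def)

lemma comp_simps [simp]:
  assumes "f \<in> Arr C" "g \<in> Arr C" "Cod C f = Dom C g"
  shows "g \<star> f \<in> Arr C" "Dom C (g \<star> f) = Dom C f" "Cod C (g \<star> f) = Cod C g"
  using comp_hom[OF arr_hom[OF assms(1)], of g "Cod C g"] assms by (auto simp: Hom_def)

lemma comp_ident [simp]: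
  "\<lbrakk>f \<in> Arr C; Cod C f = Y\<rbrakk> \<Longrightarrow> Ident C Y \<star> f = f"
  "\<lbrakk>f \<in> Arr C; Dom C f = X\<rbrakk> \<Longrightarrow> f \<star> Ident C X = f"
  by (auto intro: comp_id_left comp_id_right in_homI)

lemma comp_assoc' [simp]:
  "\<lbrakk>f \<in> Arr C; g \<in> Arr C; h \<in> Arr C; Cod C f = Dom C g; Cod C g = Dom C h\<rbrakk>
    \<Longrightarrow> (h \<star> g) \<star> f = h \<star> (g \<star> f)"
  by (rule comp_assoc) (auto intro: in_homI)

text \<open>For rewriting with \<open>q \<star> p = r\<close> under the right-nested normal form of composites.\<close>

lemma comp_reassoc:
  assumes "q \<star> p = r" "f \<in> Arr C" "p \<in> Arr C" "q \<in> Arr C" "Cod C f = Dom C p" "Cod C p = Dom C q"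
  shows "q \<star> (p \<star> f) = r \<star> f"
  using assms by (simp flip: comp_assoc')

lemma inverse_arrows_unique:
  assumes "inverse_arrows C f g" "inverse_arrows C f h"
  shows "g = h"
proof -
  have mem: "f \<in> Arr C" "g \<in> Arr C" "h \<in> Arr C" "Dom C g = Cod C f" "Cod C g = Dom C f"
      "Dom C h = Cod C f" "Cod C h = Dom C f"
    using assms by (auto simp: inverse_arrows_def Hom_def)
  have "g = g \<star> (f \<star> h)"
    using assms mem by (simp add: inverse_arrows_def)
  also have "\<dots> = (g \<star> f) \<star> h"
    using mem by simp
  also have "\<dots> = h"
    using assms mem by (simp only: inverse_arrows_def) simp
  finally show ?thesis .
qed

lemma inv_arrow_eqI: "inverse_arrows C f g \<Longrightarrow> inv_arrow C f = g"
  unfolding inv_arrow_def using inverse_arrows_unique by blast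

lemma inverse_inv_arrow: "iso_arrow C f \<Longrightarrow> inverse_arrows C f (inv_arrow C f)"
  using inv_arrow_eqI by (auto simp: iso_arrow_def)

lemma inv_arrow_simps [simp]:
  assumes "iso_arrow C f"
  shows "inv_arrow C f \<in> Arr C" "Dom C (inv_arrow C f) = Cod C f" "Cod C (inv_arrow C f) = Dom C f"
    "inv_arrow C f \<star> f = Ident C (Dom C f)" "f \<star> inv_arrow C f = Ident C (Cod C f)"
  using inverse_inv_arrow[OF assms] by (auto simp: inverse_arrows_def Hom_def)

lemma iso_arr: "iso_arrow C f \<Longrightarrow> f \<in> Arr C"
  by (auto simp: iso_arrow_def inverse_arrows_def)

lemma inv_arrow_cancel [simp]:
  assumes "iso_arrow C f" "h \<in> Arr C"
  shows "Cod C h = Dom C f \<Longrightarrow> inv_arrow C f \<star> (f \<star> h) = h"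
    and "Cod C h = Cod C f \<Longrightarrow> f \<star> (inv_arrow C f \<star> h) = h"
proof -
  note f = assms(1) iso_arr[OF assms(1)]
  show "inv_arrow C f \<star> (f \<star> h) = h" if "Cod C h = Dom C f"
    using comp_reassoc[OF inv_arrow_simps(4)[OF f(1)] assms(2)] f that assms(2) by simp
  show "f \<star> (inv_arrow C f \<star> h) = h" if "Cod C h = Cod C f"
    using comp_reassoc[OF inv_arrow_simps(5)[OF f(1)] assms(2)] f that assms(2) by simp
qed

lemma isoI:
  assumes "f \<in> Arr C" "g \<in> Arr C" "Dom C g = Cod C f" "Cod C g = Dom C f"
    "g \<star> f = Ident C (Dom C f)" "f \<star> g = Ident C (Cod C f)"
  shows "iso_arrow C f"
  using assms by (auto simp: iso_arrow_def inverse_arrows_def Hom_def)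

lemma iso_ident [simp]: "X \<in> Obj C \<Longrightarrow> iso_arrow C (Ident C X)"
  by (rule isoI[of _ "Ident C X"]) simp_all

lemma iso_inv [simp]: "iso_arrow C f \<Longrightarrow> iso_arrow C (inv_arrow C f)"
  by (rule isoI[of _ f]) (simp_all add: iso_arr)

lemma iso_comp [simp]:
  assumes "iso_arrow C f" "iso_arrow C g" "Cod C f = Dom C g"
  shows "iso_arrow C (g \<star> f)"
  by (rule isoI[of _ "inv_arrow C f \<star> inv_arrow C g"]) (use assms in \<open>simp_all add: iso_arr\<close>)

lemma aut_carrier: "f \<in> carrier (Aut C X) \<longleftrightarrow> iso_arrow C f \<and> Dom C f = X \<and> Cod C f = X"
  by (auto simp: Aut_def Hom_def iso_arr)

lemma aut_mult [simp]: "f \<otimes>\<^bsub>Aut C X\<^esub> g = f \<star> g"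
  by (simp add: Aut_def)

lemma aut_one [simp]: "\<one>\<^bsub>Aut C X\<^esub> = Ident C X"
  by (simp add: Aut_def)

lemma group_Aut: "X \<in> Obj C \<Longrightarrow> group (Aut C X)"
proof (rule groupI)
  show "\<exists>g\<in>carrier (Aut C X). g \<otimes>\<^bsub>Aut C X\<^esub> f = \<one>\<^bsub>Aut C X\<^esub>" if "f \<in> carrier (Aut C X)" for f
    using that by (intro bexI[of _ "inv_arrow C f"]) (simp_all add: aut_carrier)
qed (auto simp: aut_carrier iso_arr)

text \<open>The relation \<open>s' = u s u\<^sup>-\<^sup>1\<close> without inverses: relations between endomorphisms are proved after
  transport along associators.\<close>

definition intertwines :: "'m \<Rightarrow> 'm \<Rightarrow> 'm \<Rightarrow> bool"
  where "intertwines u s s' \<longleftrightarrow> iso_arrow C u \<and> s \<in> Hom C (Dom C u) (Dom C u) \<and>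
    s' \<in> Hom C (Cod C u) (Cod C u) \<and> u \<star> s = s' \<star> u"

lemma intertwinesI:
  assumes "iso_arrow C u" "s \<in> Arr C" "Dom C s = Dom C u" "Cod C s = Dom C u"
    "s' \<in> Arr C" "Dom C s' = Cod C u" "Cod C s' = Cod C u" "u \<star> s = s' \<star> u"
  shows "intertwines u s s'"
  using assms by (simp add: intertwines_def Hom_def)

lemma intertwinesD:
  assumes "intertwines u s s'"
  shows "iso_arrow C u" "u \<in> Arr C" "s \<in> Arr C" "Dom C s = Dom C u" "Cod C s = Dom C u"
    "s' \<in> Arr C" "Dom C s' = Cod C u" "Cod C s' = Cod C u" "u \<star> s = s' \<star> u"
  using assms by (auto simp: intertwines_def Hom_def iso_arr)

lemma intertwines_comp:
  assumes "intertwines u s s'" "intertwines u t t'"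
  shows "intertwines u (s \<star> t) (s' \<star> t')"
proof -
  note a = intertwinesD[OF assms(1)] and b = intertwinesD[OF assms(2)]
  have "u \<star> (s \<star> t) = s' \<star> (u \<star> t)"
    using comp_reassoc[OF a(9), of t] a b by simp
  then show ?thesis
    using a b by (intro intertwinesI) simp_all
qed

lemma intertwines_trans:
  assumes "intertwines u s s'" "intertwines v s' s''"
  shows "intertwines (v \<star> u) s s''"
proof -
  note a = intertwinesD[OF assms(1)] and b = intertwinesD[OF assms(2)]
  have uv: "Cod C u = Dom C v"
    using a b by simp
  then have "v \<star> (u \<star> s) = s'' \<star> (v \<star> u)"
    using comp_reassoc[OF b(9), of u] a b by simp
  then show ?thesis
    using a b uv by (intro intertwinesI) simp_all
qed

lemma intertwines_inv:
  assumes "intertwines u s s'"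
  shows "intertwines (inv_arrow C u) s' s"
proof -
  note a = intertwinesD[OF assms]
  have "inv_arrow C u \<star> s' = inv_arrow C u \<star> ((s' \<star> u) \<star> inv_arrow C u)"
    using a(1-8) by simp
  also have "\<dots> = s \<star> inv_arrow C u"
    using a(1-8) by (simp flip: a(9))
  finally show ?thesis
    using a by (intro intertwinesI) simp_all
qed

text \<open>Transport along an isomorphism is injective: two composites agree once they are
  transported to the same arrow. Beyond the smallest powers, the relations at the last crossing are
  obtained in this way.\<close>

lemma intertwines_inj:
  assumes "intertwines u s r" "intertwines u t r"
  shows "s = t"
proof -
  note a = intertwinesD[OF assms(1)] and b = intertwinesD[OF assms(2)]
  have "s = inv_arrow C u \<star> (u \<star> s)" "t = inv_arrow C u \<star> (u \<star> t)"
    using a(1-5) b(1-5) by simp_all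
  then show ?thesis
    using a(9) b(9) by simp
qed

lemma intertwines_ident:
  "\<lbrakk>s \<in> Arr C; Dom C s = X; Cod C s = X; X \<in> Obj C\<rbrakk> \<Longrightarrow> intertwines (Ident C X) s s"
  by (rule intertwinesI) simp_all

definition conj_by :: "'m \<Rightarrow> 'm \<Rightarrow> 'm"
  where "conj_by u s = u \<star> (s \<star> inv_arrow C u)"

lemma conj_by_hom:
  assumes "iso_arrow C u"
  shows "conj_by u \<in> hom (Aut C (Dom C u)) (Aut C (Cod C u))"
  by (rule homI) (use assms in \<open>auto simp: aut_carrier conj_by_def iso_arr\<close>)

lemma conj_by_intertwines:
  assumes "intertwines u s s'"
  shows "conj_by u s = s'"
proof -
  note a = intertwinesD[OF assms]
  have "conj_by u s = (u \<star> s) \<star> inv_arrow C u"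
    using a(1-5) by (simp add: conj_by_def)
  then show ?thesis
    using a by simp
qed

lemma intertwines_conj_by:
  "\<lbrakk>iso_arrow C u; s \<in> carrier (Aut C (Dom C u))\<rbrakk> \<Longrightarrow> intertwines u s (conj_by u s)"
  by (rule intertwinesI) (auto simp: aut_carrier conj_by_def iso_arr)

lemma conj_by_inj: "iso_arrow C u \<Longrightarrow> inj_on (conj_by u) (carrier (Aut C (Dom C u)))"
  by (rule inj_onI) (metis intertwines_conj_by intertwines_inj)

end

context cat_functor
begin

lemma functor_simps [simp]:
  assumes "f \<in> Arr C"
  shows "Fa f \<in> Arr D" "Dom D (Fa f) = Fo (Dom C f)" "Cod D (Fa f) = Fo (Cod C f)"
  using functor_hom[OF source.arr_hom[OF assms]] by (auto simp: Hom_def)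

lemma functor_comp':
  "\<lbrakk>f \<in> Arr C; g \<in> Arr C; Cod C f = Dom C g\<rbrakk> \<Longrightarrow> Fa (g \<star>\<^bsub>C\<^esub> f) = Fa g \<star>\<^bsub>D\<^esub> Fa f"
  by (rule functor_comp) (auto intro: source.in_homI)

lemma functor_iso [simp]:
  assumes "iso_arrow C f"
  shows "iso_arrow D (Fa f)"
proof (rule target.isoI[of _ "Fa (inv_arrow C f)"])
  show "Fa (inv_arrow C f) \<star>\<^bsub>D\<^esub> Fa f = Ident D (Dom D (Fa f))"
    using assms by (simp add: source.iso_arr functor_id flip: functor_comp')
  show "Fa f \<star>\<^bsub>D\<^esub> Fa (inv_arrow C f) = Ident D (Cod D (Fa f))"
    using assms by (simp add: source.iso_arr functor_id flip: functor_comp')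
qed (use assms in \<open>simp_all add: source.iso_arr\<close>)

lemma functor_aut_hom: "Fa \<in> hom (Aut C X) (Aut D (Fo X))"
  by (rule homI) (auto simp: source.aut_carrier target.aut_carrier source.iso_arr functor_comp')

end

section \<open>Monoidal categories\<close>

context monoidal_category
begin

declare tens_obj [simp] unit_obj [simp]

lemma tens_simps [simp]:
  assumes "f \<in> Arr C" "g \<in> Arr C"
  shows "f \<boxtimes>\<^sub>a g \<in> Arr C" "Dom C (f \<boxtimes>\<^sub>a g) = Dom C f \<boxtimes> Dom C g" "Cod C (f \<boxtimes>\<^sub>a g) = Cod C f \<boxtimes> Cod C g"
  using tens_hom[OF arr_hom[OF assms(1)] arr_hom[OF assms(2)]] by (auto simp: Hom_def)

lemma tens_comp' [simp]:
  "\<lbrakk>f \<in> Arr C; f' \<in> Arr C; g \<in> Arr C; g' \<in> Arr C; Cod C f = Dom C f'; Cod C g = Dom C g'\<rbrakk>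
    \<Longrightarrow> (f' \<boxtimes>\<^sub>a g') \<star> (f \<boxtimes>\<^sub>a g) = (f' \<star> f) \<boxtimes>\<^sub>a (g' \<star> g)"
  by (rule tens_comp[symmetric]) (auto intro: in_homI)

declare tens_id [simp]

lemma assoc_simps [simp]:
  assumes "X \<in> Obj C" "Y \<in> Obj C" "Z \<in> Obj C"
  shows "Assoc C X Y Z \<in> Arr C" "Dom C (Assoc C X Y Z) = (X \<boxtimes> Y) \<boxtimes> Z"
    "Cod C (Assoc C X Y Z) = X \<boxtimes> (Y \<boxtimes> Z)" "iso_arrow C (Assoc C X Y Z)"
  using assoc_hom[OF assms] assoc_iso[OF assms] by (auto simp: Hom_def)

lemma iso_tens [simp]:
  assumes "iso_arrow C f" "iso_arrow C g"
  shows "iso_arrow C (f \<boxtimes>\<^sub>a g)"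
  by (rule isoI[of _ "inv_arrow C f \<boxtimes>\<^sub>a inv_arrow C g"]) (use assms in \<open>simp_all add: iso_arr\<close>)

lemma intertwines_tens:
  assumes "intertwines u s s'" "intertwines v t t'"
  shows "intertwines (u \<boxtimes>\<^sub>a v) (s \<boxtimes>\<^sub>a t) (s' \<boxtimes>\<^sub>a t')"
  using intertwinesD[OF assms(1)] intertwinesD[OF assms(2)] by (intro intertwinesI) simp_all

lemma intertwines_assoc:
  assumes "f \<in> Hom C X X" "g \<in> Hom C Y Y" "h \<in> Hom C Z Z"
    and "X \<in> Obj C" "Y \<in> Obj C" "Z \<in> Obj C"
  shows "intertwines (Assoc C X Y Z) ((f \<boxtimes>\<^sub>a g) \<boxtimes>\<^sub>a h) (f \<boxtimes>\<^sub>a (g \<boxtimes>\<^sub>a h))"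
  using assms assoc_natural[OF assms(1-3)] by (intro intertwinesI) (auto simp: Hom_def)

lemma whisker_right_hom:
  assumes "X \<in> Obj C" "Y \<in> Obj C"
  shows "(\<lambda>s. s \<boxtimes>\<^sub>a Ident C Y) \<in> hom (Aut C X) (Aut C (X \<boxtimes> Y))"
  by (rule homI) (use assms in \<open>auto simp: aut_carrier iso_arr\<close>)

end

section \<open>Powers of an object in a balanced category\<close>

context braided_category
begin

lemma braid_simps [simp]:
  assumes "X \<in> Obj C" "Y \<in> Obj C"
  shows "Braid C X Y \<in> Arr C" "Dom C (Braid C X Y) = X \<boxtimes> Y" "Cod C (Braid C X Y) = Y \<boxtimes> X"
    "iso_arrow C (Braid C X Y)"
  using braid_hom[OF assms] braid_iso[OF assms] by (auto simp: Hom_def)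

text \<open>\<open>hexagon2\<close> with an associator moved across. When \<open>X\<close> is a
  left-nested power and \<open>Y\<close>, \<open>Z\<close> are the base object, the last three
  factors on the right form the last crossing \<open>left_braid\<close>.\<close>

lemma braid_past_last:
  assumes "X \<in> Obj C" "Y \<in> Obj C" "Z \<in> Obj C"
  shows "inv_arrow C (Assoc C Z X Y) \<star> Braid C (X \<boxtimes> Y) Z =
    (Braid C X Z \<boxtimes>\<^sub>a Ident C Y) \<star> inv_arrow C (Assoc C X Z Y) \<star> (Ident C X \<boxtimes>\<^sub>a Braid C Y Z) \<star> Assoc C X Y Z"
proof -
  have "inv_arrow C (Assoc C Z X Y) \<star> Braid C (X \<boxtimes> Y) Z =
      (inv_arrow C (Assoc C Z X Y) \<star> Braid C (X \<boxtimes> Y) Z \<star> inv_arrow C (Assoc C X Y Z)) \<star> Assoc C X Y Z"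
    using assms by simp
  also have "\<dots> = (Braid C X Z \<boxtimes>\<^sub>a Ident C Y) \<star> inv_arrow C (Assoc C X Z Y) \<star>
      (Ident C X \<boxtimes>\<^sub>a Braid C Y Z) \<star> Assoc C X Y Z"
    unfolding hexagon2[OF assms] using assms by simp
  finally show ?thesis .
qed

text \<open>\<open>hexagon1\<close> solved for the braiding. When \<open>Y\<close> is a left-nested
  power and \<open>X\<close>, \<open>Z\<close> are the base object, the first three factors on the
  right form the last crossing.\<close>

lemma braid_before_last:
  assumes "X \<in> Obj C" "Y \<in> Obj C" "Z \<in> Obj C"
  shows "Braid C X (Y \<boxtimes> Z) =
    inv_arrow C (Assoc C Y Z X) \<star> (Ident C Y \<boxtimes>\<^sub>a Braid C X Z) \<star> Assoc C Y X Z \<star>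
      (Braid C X Y \<boxtimes>\<^sub>a Ident C Z) \<star> inv_arrow C (Assoc C X Y Z)"
proof -
  have "Braid C X (Y \<boxtimes> Z) = inv_arrow C (Assoc C Y Z X) \<star>
      (Assoc C Y Z X \<star> Braid C X (Y \<boxtimes> Z) \<star> Assoc C X Y Z) \<star> inv_arrow C (Assoc C X Y Z)"
    using assms by simp
  also have "\<dots> = inv_arrow C (Assoc C Y Z X) \<star> (Ident C Y \<boxtimes>\<^sub>a Braid C X Z) \<star> Assoc C Y X Z \<star>
      (Braid C X Y \<boxtimes>\<^sub>a Ident C Z) \<star> inv_arrow C (Assoc C X Y Z)"
    unfolding hexagon1[OF assms] using assms by simp
  finally show ?thesis .
qed

text \<open>The Yang--Baxter equation is naturality of \<open>\<beta>\<^bsub>X,X\<otimes>X\<^esub>\<close> with respect to \<open>\<beta>\<^bsub>X,X\<^esub>\<close>.\<close>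

lemma yang_baxter:
  fixes X defines "b \<equiv> Braid C X X" and "I \<equiv> Ident C X" and "a \<equiv> Assoc C X X X"
  defines "s \<equiv> inv_arrow C a \<star> (I \<boxtimes>\<^sub>a b) \<star> a"
  assumes X: "X \<in> Obj C"
  shows "(b \<boxtimes>\<^sub>a I) \<star> s \<star> (b \<boxtimes>\<^sub>a I) = s \<star> (b \<boxtimes>\<^sub>a I) \<star> s"
proof -
  define B where "B = Braid C X (X \<boxtimes> X)"
  note defs = b_def I_def a_def
  \<comment> \<open>By the hexagon, \<open>B\<close> is
    \<open>s \<star> (b \<boxtimes>\<^sub>a I)\<close> composed with the inverse of
    \<open>a\<close>; precomposing the naturality square with \<open>a\<close> therefore gives the
    two sides of the claim.\<close>
  have B: "B = inv_arrow C a \<star> (I \<boxtimes>\<^sub>a b) \<star> a \<star> (b \<boxtimes>\<^sub>a I) \<star> inv_arrow C a"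
    using braid_before_last[OF X X X] by (simp add: B_def defs)
  have "B \<star> (I \<boxtimes>\<^sub>a b) = (b \<boxtimes>\<^sub>a I) \<star> B"
    unfolding B_def defs using X by (intro braid_natural id_hom braid_hom)
  then have "(B \<star> (I \<boxtimes>\<^sub>a b)) \<star> a = ((b \<boxtimes>\<^sub>a I) \<star> B) \<star> a"
    by simp
  moreover have "(B \<star> (I \<boxtimes>\<^sub>a b)) \<star> a = s \<star> (b \<boxtimes>\<^sub>a I) \<star> s"
    unfolding B s_def using X by (simp add: defs del: tens_comp')
  moreover have "((b \<boxtimes>\<^sub>a I) \<star> B) \<star> a = (b \<boxtimes>\<^sub>a I) \<star> s \<star> (b \<boxtimes>\<^sub>a I)"
    unfolding B s_def using X by (simp add: defs del: tens_comp')
  ultimately show ?thesis by simp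
qed

end

locale power_of_object = balanced_category C
  for C :: "('o, 'm, 'e) balanced_cat_scheme" (structure) +
  fixes X :: 'o
  assumes X [simp]: "X \<in> Obj C"
begin

abbreviation L where "L \<equiv> left_power C X"

abbreviation S where "S \<equiv> left_braid C X"

abbreviation Mg where "Mg \<equiv> merge_powers C X"

lemma left_power_obj [simp]: "L m \<in> Obj C"
proof (cases m)
  case (Suc k)
  have "L (Suc k) \<in> Obj C" for k
    by (induction k) simp_all
  then show ?thesis by (simp add: Suc)
qed simp

lemma twist_simps [simp]:
  assumes "Y \<in> Obj C"
  shows "Twist C Y \<in> Arr C" "Dom C (Twist C Y) = Y" "Cod C (Twist C Y) = Y" "iso_arrow C (Twist C Y)"
  using twist_aut[OF assms] by (auto simp: aut_carrier iso_arr)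

lemma left_power_Suc: "m \<ge> 1 \<Longrightarrow> L (Suc m) = L m \<boxtimes> X"
  by (cases m) simp_all

text \<open>The counterpart of \<open>strand_twist\<close> for left-nested powers, by recursion on
  the number of strands, so that adding a strand is whiskering.\<close>

fun left_twist :: "nat \<Rightarrow> nat \<Rightarrow> 'm" where
  "left_twist 0 i = Ident C (Unit C)"
| "left_twist (Suc 0) i = Twist C X"
| "left_twist (Suc (Suc k)) i =
    (if i \<le> Suc k then left_twist (Suc k) i \<boxtimes>\<^sub>a Ident C X else Ident C (L (Suc k)) \<boxtimes>\<^sub>a Twist C X)"

lemma left_twist_Suc:
  "m \<ge> 1 \<Longrightarrow> left_twist (Suc m) i =
    (if i \<le> m then left_twist m i \<boxtimes>\<^sub>a Ident C X else Ident C (L m) \<boxtimes>\<^sub>a Twist C X)"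
  by (cases m) simp_all

lemma left_twist_aut: "m \<ge> 1 \<Longrightarrow> left_twist m i \<in> carrier (Aut C (L m))"
proof (induction m rule: dec_induct)
  case base
  then show ?case by (simp add: aut_carrier)
next
  case (step m)
  then show ?case
    by (auto simp: aut_carrier left_twist_Suc left_power_Suc iso_arr)
qed

lemma left_twist_simps [simp]:
  assumes "m \<ge> 1"
  shows "left_twist m i \<in> Arr C" "Dom C (left_twist m i) = L m" "Cod C (left_twist m i) = L m"
    "iso_arrow C (left_twist m i)"
  using left_twist_aut[OF assms, of i] by (auto simp: aut_carrier iso_arr)

text \<open>This rule and the next two separate the branches of \<open>left_braid\<close> and
  replace its defining equations in the sequel.\<close>

lemma left_braid_whisker: "i < m \<Longrightarrow> S (Suc m) i = S m i \<boxtimes>\<^sub>a Ident C X"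
  by simp

lemma left_braid_two: "S (Suc (Suc 0)) (Suc 0) = Braid C X X"
  by simp

lemma left_braid_last:
  "m \<ge> 1 \<Longrightarrow> S (Suc (Suc m)) (Suc m) =
    inv_arrow C (Assoc C (L m) X X) \<star> (Ident C (L m) \<boxtimes>\<^sub>a Braid C X X) \<star> Assoc C (L m) X X"
  by (simp add: Let_def)

declare left_braid.simps [simp del]

lemma left_braid_aut: "\<lbrakk>1 \<le> i; i < m\<rbrakk> \<Longrightarrow> S m i \<in> carrier (Aut C (L m))"
proof (induction m)
  case (Suc m)
  then have m: "L (Suc m) = L m \<boxtimes> X"
    by (intro left_power_Suc) simp
  consider "i < m" | "m = 1" "i = 1" | k where "m = Suc k" "k \<ge> 1" "i = m"
    using Suc.prems by (cases m) fastforce+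
  then show ?case
  proof cases
    case 1
    then show ?thesis
      using Suc by (simp add: m left_braid_whisker aut_carrier iso_arr)
  next
    case 2
    then show ?thesis
      by (simp add: left_braid_two aut_carrier)
  next
    case 3
    then show ?thesis
      by (simp add: m left_braid_last left_power_Suc aut_carrier iso_arr)
  qed
qed simp

lemma left_braid_simps [simp]:
  assumes "1 \<le> i" "i < m"
  shows "S m i \<in> Arr C" "Dom C (S m i) = L m" "Cod C (S m i) = L m" "iso_arrow C (S m i)"
  using left_braid_aut[OF assms] by (auto simp: aut_carrier iso_arr)

lemma left_braid_last_intertwines:
  "m \<ge> 1 \<Longrightarrow> intertwines (Assoc C (L m) X X) (S (Suc (Suc m)) (Suc m)) (Ident C (L m) \<boxtimes>\<^sub>a Braid C X X)"
  by (rule intertwinesI) (simp_all add: left_braid_last left_power_Suc)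

lemma whisker_twice_intertwines:
  assumes "m \<ge> 1" "s \<in> carrier (Aut C (L m))"
  shows "intertwines (Assoc C (L m) X X) ((s \<boxtimes>\<^sub>a Ident C X) \<boxtimes>\<^sub>a Ident C X) (s \<boxtimes>\<^sub>a Ident C (X \<boxtimes> X))"
  using intertwines_assoc[of s "L m" "Ident C X" X "Ident C X" X] assms
  by (auto simp: aut_carrier Hom_def iso_arr)

text \<open>Only the last crossing, \<open>j = m\<close> on m + 1 strands, is not covered by
  whiskering. After reassociation it acts on the final two factors and the other crossing on the
  power before them, so they commute by interchange.\<close>

lemma left_braid_far:
  "\<lbrakk>1 \<le> i; i + 2 \<le> j; j < m\<rbrakk> \<Longrightarrow> S m i \<star> S m j = S m j \<star> S m i"
proof (induction m)
  case (Suc m)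
  show ?case
  proof (cases "j < m")
    case True
    then have "S m i \<star> S m j = S m j \<star> S m i"
      using Suc by simp
    then show ?thesis
      using True Suc.prems by (simp add: left_braid_whisker)
  next
    case False
    define k where "k = m - 1"
    have k: "m = Suc k" "j = Suc k" "i < k" "k \<ge> 1"
      using False Suc.prems by (auto simp: k_def)
    have "S (Suc m) i = (S k i \<boxtimes>\<^sub>a Ident C X) \<boxtimes>\<^sub>a Ident C X"
      using k by (simp add: left_braid_whisker)
    then have 1: "intertwines (Assoc C (L k) X X) (S (Suc m) i) (S k i \<boxtimes>\<^sub>a Ident C (X \<boxtimes> X))"
      using whisker_twice_intertwines[OF k(4) left_braid_aut[OF Suc.prems(1) k(3)]] by simp
    have 2: "intertwines (Assoc C (L k) X X) (S (Suc m) j) (Ident C (L k) \<boxtimes>\<^sub>a Braid C X X)"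
      using left_braid_last_intertwines[OF k(4)] k by simp
    show ?thesis
      using intertwines_comp[OF 1 2] intertwines_comp[OF 2 1] k Suc.prems
      by (intro intertwines_inj[of "Assoc C (L k) X X"]) simp_all
  qed
qed simp

text \<open>Whiskering leaves the case of the last three strands. On exactly three strands it is the
  Yang-Baxter equation itself; otherwise that equation is tensored with a left-nested power
  \<open>?Y\<close> and transported back.\<close>

lemma left_braid_near:
  "\<lbrakk>1 \<le> i; i + 1 < m\<rbrakk> \<Longrightarrow> S m i \<star> (S m (i + 1) \<star> S m i) = S m (i + 1) \<star> (S m i \<star> S m (i + 1))"
proof (induction m)
  case (Suc m)
  consider "i + 1 < m" | "m = 2" "i = 1" | k where "m = Suc (Suc k)" "k \<ge> 1" "i = Suc k"
  proof (cases "i + 1 < m \<or> i = 1")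
    case True
    then show ?thesis using that Suc.prems by force
  next
    case False
    then have "m = Suc (Suc (i - 1))" "i - 1 \<ge> 1" "i = Suc (i - 1)"
      using Suc.prems by auto
    then show ?thesis by (rule that(3))
  qed
  then show ?case
  proof cases
    case 1
    then have "S m i \<star> (S m (i + 1) \<star> S m i) = S m (i + 1) \<star> (S m i \<star> S m (i + 1))"
      using Suc by simp
    then show ?thesis
      using 1 Suc.prems by (simp add: left_braid_whisker)
  next
    case 2
    have "S (Suc m) i = Braid C X X \<boxtimes>\<^sub>a Ident C X"
      using 2 left_braid_whisker[of 1 2] left_braid_two by (simp add: numeral_2_eq_2)
    moreover have "S (Suc m) (i + 1) = inv_arrow C (Assoc C X X X) \<star> (Ident C X \<boxtimes>\<^sub>a Braid C X X) \<star> Assoc C X X X"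
      using 2 left_braid_last[of 1] by (simp add: numeral_2_eq_2)
    ultimately show ?thesis
      using yang_baxter[OF X] by simp
  next
    case 3
    let ?Y = "L k" and ?I = "Ident C X" and ?b = "Braid C X X"
    let ?s = "inv_arrow C (Assoc C X X X) \<star> (?I \<boxtimes>\<^sub>a ?b) \<star> Assoc C X X X"
    let ?a = "Assoc C ?Y X X \<boxtimes>\<^sub>a ?I"
    \<comment> \<open>\<open>?u\<close> moves the last three strands together as ((X X) X), where
      the first crossing is visible; \<open>?v\<close> moves them together as (X (X X)), where the
      second is. The pentagon identifies \<open>?v\<close> with \<open>?u\<close> followed by an
      associator on these strands, so both crossings can be compared along
      \<open>?u\<close>.\<close>
    let ?u = "Assoc C ?Y (X \<boxtimes> X) X \<star> ?a"
    let ?v = "Assoc C ?Y X (X \<boxtimes> X) \<star> Assoc C (?Y \<boxtimes> X) X X"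
    have L: "L (Suc m) = ((?Y \<boxtimes> X) \<boxtimes> X) \<boxtimes> X" "L m = (?Y \<boxtimes> X) \<boxtimes> X"
      using 3 by (simp_all add: left_power_Suc)
    have "intertwines ?a (S m i \<boxtimes>\<^sub>a ?I) ((Ident C ?Y \<boxtimes>\<^sub>a ?b) \<boxtimes>\<^sub>a ?I)"
      using left_braid_last_intertwines[OF 3(2)] 3 by (intro intertwines_tens intertwines_ident) simp_all
    moreover have "S (Suc m) i = S m i \<boxtimes>\<^sub>a ?I"
      using 3 by (simp add: left_braid_whisker)
    moreover have "intertwines (Assoc C ?Y (X \<boxtimes> X) X) ((Ident C ?Y \<boxtimes>\<^sub>a ?b) \<boxtimes>\<^sub>a ?I) (Ident C ?Y \<boxtimes>\<^sub>a (?b \<boxtimes>\<^sub>a ?I))"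
      by (intro intertwines_assoc id_hom braid_hom) simp_all
    ultimately have 1: "intertwines ?u (S (Suc m) i) (Ident C ?Y \<boxtimes>\<^sub>a (?b \<boxtimes>\<^sub>a ?I))"
      using intertwines_trans by simp
    have "intertwines (Assoc C (?Y \<boxtimes> X) X X) (S (Suc m) (i + 1)) (Ident C (?Y \<boxtimes> X) \<boxtimes>\<^sub>a ?b)"
      using left_braid_last_intertwines[of "Suc k"] 3 by (simp add: left_power_Suc)
    moreover have "intertwines (Assoc C ?Y X (X \<boxtimes> X)) ((Ident C ?Y \<boxtimes>\<^sub>a ?I) \<boxtimes>\<^sub>a ?b) (Ident C ?Y \<boxtimes>\<^sub>a (?I \<boxtimes>\<^sub>a ?b))"
      by (intro intertwines_assoc id_hom braid_hom) simp_all
    ultimately have v: "intertwines ?v (S (Suc m) (i + 1)) (Ident C ?Y \<boxtimes>\<^sub>a (?I \<boxtimes>\<^sub>a ?b))"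
      by (intro intertwines_trans) (simp_all del: intertwines_def)
    have "intertwines (Assoc C X X X) ?s (?I \<boxtimes>\<^sub>a ?b)"
      by (rule intertwinesI) simp_all
    then have "intertwines (Ident C ?Y \<boxtimes>\<^sub>a Assoc C X X X) (Ident C ?Y \<boxtimes>\<^sub>a ?s) (Ident C ?Y \<boxtimes>\<^sub>a (?I \<boxtimes>\<^sub>a ?b))"
      by (intro intertwines_tens intertwines_ident) simp_all
    from intertwines_trans[OF v intertwines_inv[OF this]]
    have "intertwines (inv_arrow C (Ident C ?Y \<boxtimes>\<^sub>a Assoc C X X X) \<star> ?v) (S (Suc m) (i + 1)) (Ident C ?Y \<boxtimes>\<^sub>a ?s)" .
    moreover have "?v = (Ident C ?Y \<boxtimes>\<^sub>a Assoc C X X X) \<star> ?u"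
      using pentagon[of ?Y X X X] by simp
    then have "inv_arrow C (Ident C ?Y \<boxtimes>\<^sub>a Assoc C X X X) \<star> ?v = ?u"
      by (simp only:) (rule inv_arrow_cancel(1); simp)
    ultimately have 2: "intertwines ?u (S (Suc m) (i + 1)) (Ident C ?Y \<boxtimes>\<^sub>a ?s)"
      by simp
    have "(Ident C ?Y \<boxtimes>\<^sub>a (?b \<boxtimes>\<^sub>a ?I)) \<star> (Ident C ?Y \<boxtimes>\<^sub>a ?s) \<star> (Ident C ?Y \<boxtimes>\<^sub>a (?b \<boxtimes>\<^sub>a ?I))
        = Ident C ?Y \<boxtimes>\<^sub>a ((?b \<boxtimes>\<^sub>a ?I) \<star> ?s \<star> (?b \<boxtimes>\<^sub>a ?I))"
      by simp
    also have "\<dots> = Ident C ?Y \<boxtimes>\<^sub>a (?s \<star> (?b \<boxtimes>\<^sub>a ?I) \<star> ?s)"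
      using yang_baxter[OF X] by simp
    also have "\<dots> = (Ident C ?Y \<boxtimes>\<^sub>a ?s) \<star> (Ident C ?Y \<boxtimes>\<^sub>a (?b \<boxtimes>\<^sub>a ?I)) \<star> (Ident C ?Y \<boxtimes>\<^sub>a ?s)"
      by simp
    finally show ?thesis
      using intertwines_comp[OF 1 intertwines_comp[OF 2 1]] intertwines_comp[OF 2 intertwines_comp[OF 1 2]]
      by (intro intertwines_inj[of ?u]) simp_all
  qed
qed simp

lemma left_twist_comm:
  "\<lbrakk>1 \<le> i; i < j; j \<le> m\<rbrakk> \<Longrightarrow> left_twist m i \<star> left_twist m j = left_twist m j \<star> left_twist m i"
proof (induction m)
  case (Suc m)
  then have m: "m \<ge> 1" by simp
  show ?case
  proof (cases "j \<le> m")
    case True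
    then have "left_twist m i \<star> left_twist m j = left_twist m j \<star> left_twist m i"
      using Suc by simp
    then show ?thesis
      using True Suc.prems m by (simp add: left_twist_Suc)
  next
    case False
    then show ?thesis
      using Suc.prems m by (simp add: left_twist_Suc)
  qed
qed simp

text \<open>Whiskering disposes of crossings before the last. For the last crossing, naturality of
  the braiding with respect to the twist exchanges the two final framings.\<close>

lemma left_braid_twist:
  "\<lbrakk>1 \<le> i; i < m; 1 \<le> j; j \<le> m\<rbrakk>
    \<Longrightarrow> S m i \<star> left_twist m j = left_twist m (transpose i (Suc i) j) \<star> S m i"
proof (induction m)
  case (Suc m)
  then have m: "m \<ge> 1" by simp
  consider "i < m" "j \<le> m" | "i < m" "j = Suc m" | "m = 1" "i = 1" | k where "m = Suc k" "k \<ge> 1" "i = Suc k"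
  proof (cases "i < m \<or> i = 1")
    case True
    then show ?thesis using that Suc.prems by force
  next
    case False
    then have "m = Suc (i - 1)" "i - 1 \<ge> 1" "i = Suc (i - 1)"
      using Suc.prems by auto
    then show ?thesis by (rule that(4))
  qed
  then show ?case
  proof cases
    case 1
    then have "S m i \<star> left_twist m j = left_twist m (transpose i (Suc i) j) \<star> S m i"
      using Suc by simp
    moreover have "transpose i (Suc i) j \<le> m"
      using 1 by (simp add: transpose_def)
    ultimately show ?thesis
      using 1 Suc.prems m by (simp add: left_twist_Suc left_braid_whisker)
  next
    case 2
    moreover have "transpose i (Suc i) j = j"
      using 2 by (simp add: transpose_def)
    ultimately show ?thesis
      using Suc.prems m by (simp add: left_twist_Suc left_braid_whisker)
  next
    case 3
    have "Braid C X X \<star> (Twist C X \<boxtimes>\<^sub>a Ident C X) = (Ident C X \<boxtimes>\<^sub>a Twist C X) \<star> Braid C X X"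
      "Braid C X X \<star> (Ident C X \<boxtimes>\<^sub>a Twist C X) = (Twist C X \<boxtimes>\<^sub>a Ident C X) \<star> Braid C X X"
      by (rule braid_natural; simp add: Hom_def)+
    moreover have "j = 1 \<or> j = 2"
      using 3 Suc.prems by auto
    ultimately show ?thesis
      using 3 left_braid_two by (auto simp: transpose_def)
  next
    case 4
    \<comment> \<open>The form taken by the twist of strand \<open>j\<close> once the last two
      factors are bracketed together.\<close>
    define tw where "tw j = (if j \<le> k then left_twist k j \<boxtimes>\<^sub>a Ident C (X \<boxtimes> X)
      else Ident C (L k) \<boxtimes>\<^sub>a (if j = Suc k then Twist C X \<boxtimes>\<^sub>a Ident C X else Ident C X \<boxtimes>\<^sub>a Twist C X))" for j
    let ?u = "Assoc C (L k) X X" and ?b = "Ident C (L k) \<boxtimes>\<^sub>a Braid C X X"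
    have twist: "intertwines ?u (left_twist (Suc m) j) (tw j)" for j
    proof -
      consider "j \<le> k" | "j = Suc k" | "j > Suc k" by linarith
      then show ?thesis
      proof cases
        case 1
        then show ?thesis
          using whisker_twice_intertwines[OF 4(2) left_twist_aut[OF 4(2), of j]] 4
          by (simp add: tw_def left_twist_Suc)
      next
        case 2
        have "intertwines ?u ((Ident C (L k) \<boxtimes>\<^sub>a Twist C X) \<boxtimes>\<^sub>a Ident C X) (Ident C (L k) \<boxtimes>\<^sub>a (Twist C X \<boxtimes>\<^sub>a Ident C X))"
          by (rule intertwines_assoc) (simp_all add: Hom_def)
        then show ?thesis
          using 2 4 by (simp add: tw_def left_twist_Suc)
      next
        case 3
        have "intertwines ?u ((Ident C (L k) \<boxtimes>\<^sub>a Ident C X) \<boxtimes>\<^sub>a Twist C X) (Ident C (L k) \<boxtimes>\<^sub>a (Ident C X \<boxtimes>\<^sub>a Twist C X))"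
          by (rule intertwines_assoc) (simp_all add: Hom_def)
        then show ?thesis
          using 3 4 by (simp add: tw_def left_twist_Suc left_power_Suc)
      qed
    qed
    have braid: "intertwines ?u (S (Suc m) i) ?b"
      using left_braid_last_intertwines[OF 4(2)] 4 by simp
    have "Braid C X X \<star> (Twist C X \<boxtimes>\<^sub>a Ident C X) = (Ident C X \<boxtimes>\<^sub>a Twist C X) \<star> Braid C X X"
      "Braid C X X \<star> (Ident C X \<boxtimes>\<^sub>a Twist C X) = (Twist C X \<boxtimes>\<^sub>a Ident C X) \<star> Braid C X X"
      by (rule braid_natural; simp add: Hom_def)+
    then have "?b \<star> tw j = tw (transpose i (Suc i) j) \<star> ?b"
      using 4 Suc.prems by (auto simp: tw_def transpose_def)
    then show ?thesis
      using intertwines_comp[OF braid twist[of j]] intertwines_comp[OF twist braid]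
      by (intro intertwines_inj[of ?u]) simp_all
  qed
qed simp

lemma framed_braid_images_left:
  assumes "m \<ge> 1"
  shows "framed_braid_images (Aut C (L m)) m (S m) (left_twist m)"
proof -
  interpret group "Aut C (L m)" by (simp add: group_Aut)
  show ?thesis
  proof
    show "S m i \<in> carrier (Aut C (L m))" if "1 \<le> i" "i < m" for i
      using that by (rule left_braid_aut)
    show "left_twist m i \<in> carrier (Aut C (L m))" for i
      using assms by (rule left_twist_aut)
  qed (unfold aut_mult, (fact left_braid_far left_braid_near left_twist_comm left_braid_twist)+)
qed

section \<open>The twist of a tensor power\<close>

lemma merge_Suc:
  "q \<ge> 1 \<Longrightarrow> Mg p (Suc q) = (Mg p q \<boxtimes>\<^sub>a Ident C X) \<star> inv_arrow C (Assoc C (L p) (L q) X)"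
  by (cases q) simp_all

lemma merge_simps [simp]:
  assumes "p \<ge> 1" "q \<ge> 1"
  shows "Mg p q \<in> Arr C" "Dom C (Mg p q) = L p \<boxtimes> L q" "Cod C (Mg p q) = L (p + q)" "iso_arrow C (Mg p q)"
proof -
  from assms(2) have "Mg p q \<in> Arr C \<and> Dom C (Mg p q) = L p \<boxtimes> L q \<and> Cod C (Mg p q) = L (p + q) \<and> iso_arrow C (Mg p q)"
  proof (induction q rule: dec_induct)
    case base
    then show ?case using assms(1) by (simp add: left_power_Suc)
  next
    case (step q)
    then show ?case
      using assms(1) by (auto simp: merge_Suc left_power_Suc)
  qed
  then show "Mg p q \<in> Arr C" "Dom C (Mg p q) = L p \<boxtimes> L q" "Cod C (Mg p q) = L (p + q)" "iso_arrow C (Mg p q)"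
    by auto
qed

text \<open>Merging two left-nested powers keeps the strands in order: those of the left power keep
  their numbers, and by \<open>merge_twist_right\<close> those of the right power are shifted by
  \<open>p\<close>.\<close>

lemma merge_twist_left:
  assumes "p \<ge> 1" "q \<ge> 1" "i \<le> p"
  shows "intertwines (Mg p q) (left_twist p i \<boxtimes>\<^sub>a Ident C (L q)) (left_twist (p + q) i)"
  using assms(2)
proof (induction q rule: dec_induct)
  case base
  then show ?case
    using assms by (simp add: left_twist_Suc left_power_Suc intertwines_ident)
next
  case (step q)
  have "intertwines (Assoc C (L p) (L q) X) ((left_twist p i \<boxtimes>\<^sub>a Ident C (L q)) \<boxtimes>\<^sub>a Ident C X)
      (left_twist p i \<boxtimes>\<^sub>a (Ident C (L q) \<boxtimes>\<^sub>a Ident C X))"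
    using assms by (intro intertwines_assoc) (simp_all add: Hom_def)
  from intertwines_trans[OF intertwines_inv[OF this] intertwines_tens[OF step.IH intertwines_ident]]
  show ?case
    using step assms by (simp add: merge_Suc left_twist_Suc left_power_Suc)
qed

lemma merge_twist_right:
  assumes "p \<ge> 1" "q \<ge> 1" "1 \<le> i" "i \<le> q"
  shows "intertwines (Mg p q) (Ident C (L p) \<boxtimes>\<^sub>a left_twist q i) (left_twist (p + q) (p + i))"
  using assms(2,4)
proof (induction q rule: dec_induct)
  case base
  then have "i = 1"
    using assms(3) by simp
  then show ?case
    using assms(1) by (simp add: left_twist_Suc left_power_Suc intertwines_ident)
next
  case (step q)
  show ?case
  proof (cases "i \<le> q")
    case True
    have "intertwines (Assoc C (L p) (L q) X) ((Ident C (L p) \<boxtimes>\<^sub>a left_twist q i) \<boxtimes>\<^sub>a Ident C X)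
        (Ident C (L p) \<boxtimes>\<^sub>a (left_twist q i \<boxtimes>\<^sub>a Ident C X))"
      using assms step by (intro intertwines_assoc) (simp_all add: Hom_def)
    from intertwines_trans[OF intertwines_inv[OF this] intertwines_tens[OF step.IH[OF True] intertwines_ident]]
    show ?thesis
      using step assms True by (simp add: merge_Suc left_twist_Suc)
  next
    case False
    have "intertwines (Assoc C (L p) (L q) X) ((Ident C (L p) \<boxtimes>\<^sub>a Ident C (L q)) \<boxtimes>\<^sub>a Twist C X)
        (Ident C (L p) \<boxtimes>\<^sub>a (Ident C (L q) \<boxtimes>\<^sub>a Twist C X))"
      using assms by (intro intertwines_assoc) (simp_all add: Hom_def)
    moreover have "intertwines (Mg p q) (Ident C (L p) \<boxtimes>\<^sub>a Ident C (L q)) (Ident C (L (p + q)))"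
      using assms step by (intro intertwinesI) simp_all
    moreover have "intertwines (Ident C X) (Twist C X) (Twist C X)"
      by (simp add: intertwines_ident)
    ultimately have "intertwines ((Mg p q \<boxtimes>\<^sub>a Ident C X) \<star> inv_arrow C (Assoc C (L p) (L q) X))
        (Ident C (L p) \<boxtimes>\<^sub>a (Ident C (L q) \<boxtimes>\<^sub>a Twist C X)) (Ident C (L (p + q)) \<boxtimes>\<^sub>a Twist C X)"
      by (blast intro: intertwines_trans intertwines_inv intertwines_tens)
    moreover have "i = Suc q"
      using False step by simp
    ultimately show ?thesis
      using step assms by (simp add: merge_Suc left_twist_Suc)
  qed
qed

abbreviation asc where "asc m \<equiv> braid_images.ascent (Aut C (L m)) (S m)"

abbreviation desc where "desc m \<equiv> braid_images.descent (Aut C (L m)) (S m)"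

lemma braid_images_left: "m \<ge> 1 \<Longrightarrow> braid_images (Aut C (L m)) m (S m)"
  using framed_braid_images_left by (simp add: framed_braid_images_def)

lemma group_hom_whisker:
  "m \<ge> 1 \<Longrightarrow> group_hom (Aut C (L m)) (Aut C (L (Suc m))) (\<lambda>s. s \<boxtimes>\<^sub>a Ident C X)"
  by (simp add: group_hom_def group_hom_axioms_def group_Aut left_power_Suc whisker_right_hom)

text \<open>Whiskering with \<open>X\<close> is a homomorphism that adds a strand on the right and
  sends each crossing to the crossing with the same index.\<close>

lemma ascent_whisker:
  assumes "k < m"
  shows "asc m k \<boxtimes>\<^sub>a Ident C X = asc (Suc m) k"
proof -
  have m: "m \<ge> 1" using assms by simp
  interpret group_hom "Aut C (L m)" "Aut C (L (Suc m))" "\<lambda>s. s \<boxtimes>\<^sub>a Ident C X"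
    using m by (rule group_hom_whisker)
  have "set (map (S m) [1..<Suc k]) \<subseteq> carrier (Aut C (L m))"
    using assms left_braid_aut by auto
  moreover have "map (\<lambda>s. s \<boxtimes>\<^sub>a Ident C X) (map (S m) [1..<Suc k]) = map (S (Suc m)) [1..<Suc k]"
    using assms by (auto simp: left_braid_whisker)
  ultimately show ?thesis
    using hom_list_mult m by (simp only: braid_images.ascent_def[OF braid_images_left] le_SucI)
qed

lemma descent_whisker:
  assumes "k < m"
  shows "desc m k \<boxtimes>\<^sub>a Ident C X = desc (Suc m) k"
proof -
  have m: "m \<ge> 1" using assms by simp
  interpret group_hom "Aut C (L m)" "Aut C (L (Suc m))" "\<lambda>s. s \<boxtimes>\<^sub>a Ident C X"
    using m by (rule group_hom_whisker)
  have "set (map (S m) (rev [1..<Suc k])) \<subseteq> carrier (Aut C (L m))"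
    using assms left_braid_aut by auto
  moreover have "map (\<lambda>s. s \<boxtimes>\<^sub>a Ident C X) (map (S m) (rev [1..<Suc k])) = map (S (Suc m)) (rev [1..<Suc k])"
    using assms by (auto simp: left_braid_whisker)
  ultimately show ?thesis
    using hom_list_mult m by (simp only: braid_images.descent_def[OF braid_images_left] le_SucI)
qed

lemma ascent_simps [simp]:
  assumes "k < m"
  shows "asc m k \<in> Arr C" "Dom C (asc m k) = L m" "Cod C (asc m k) = L m" "iso_arrow C (asc m k)"
    "desc m k \<in> Arr C" "Dom C (desc m k) = L m" "Cod C (desc m k) = L m" "iso_arrow C (desc m k)"
proof -
  have "asc m k \<in> carrier (Aut C (L m))" "desc m k \<in> carrier (Aut C (L m))"
    using assms by (auto intro!: braid_images.ascent_closed braid_images.descent_closed braid_images_left)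
  then show "asc m k \<in> Arr C" "Dom C (asc m k) = L m" "Cod C (asc m k) = L m" "iso_arrow C (asc m k)"
    "desc m k \<in> Arr C" "Dom C (desc m k) = L m" "Cod C (desc m k) = L m" "iso_arrow C (desc m k)"
    by (auto simp: aut_carrier iso_arr)
qed

text \<open>The last strand moves left across the m others, crossing its neighbour first;
  composition is read from the right, hence the ascending product. \<open>Mg 1 m\<close> restores
  the left-nested bracketing of the target.\<close>

lemma merge_braid_ascent:
  "m \<ge> 1 \<Longrightarrow> Mg 1 m \<star> Braid C (L m) X = asc (Suc m) m"
proof (induction m rule: dec_induct)
  case base
  interpret braid_images "Aut C (L 2)" 2 "S 2" by (rule braid_images_left) simp
  show ?case
    using ascent_Suc[of 0] ascent_0 left_braid_two by (simp add: numeral_2_eq_2)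
next
  case (step m)
  interpret braid_images "Aut C (L (Suc (Suc m)))" "Suc (Suc m)" "S (Suc (Suc m))"
    by (rule braid_images_left) simp
  have "Mg 1 (Suc m) \<star> Braid C (L (Suc m)) X
      = (Mg 1 m \<boxtimes>\<^sub>a Ident C X) \<star> inv_arrow C (Assoc C X (L m) X) \<star> Braid C (L m \<boxtimes> X) X"
    using step by (simp add: merge_Suc left_power_Suc)
  also have "\<dots> = (Mg 1 m \<boxtimes>\<^sub>a Ident C X) \<star> (Braid C (L m) X \<boxtimes>\<^sub>a Ident C X) \<star> S (Suc (Suc m)) (Suc m)"
    using step by (simp add: braid_past_last left_braid_last)
  also have "\<dots> = ((Mg 1 m \<star> Braid C (L m) X) \<boxtimes>\<^sub>a Ident C X) \<star> S (Suc (Suc m)) (Suc m)"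
    using step comp_reassoc[of "Mg 1 m \<boxtimes>\<^sub>a Ident C X" "Braid C (L m) X \<boxtimes>\<^sub>a Ident C X" _ "S (Suc (Suc m)) (Suc m)"]
    by (simp add: left_power_Suc)
  also have "\<dots> = asc (Suc (Suc m)) (Suc m)"
    by (simp only: step.IH ascent_whisker ascent_Suc aut_mult lessI)
  finally show ?case .
qed

text \<open>The mirror situation: the first strand moves right, so sigma_1 is applied first and the
  product descends. Here it is the source that must be rebracketed.\<close>

lemma braid_descent_merge:
  "m \<ge> 1 \<Longrightarrow> Braid C X (L m) = desc (Suc m) m \<star> Mg 1 m"
proof (induction m rule: dec_induct)
  case base
  interpret braid_images "Aut C (L 2)" 2 "S 2" by (rule braid_images_left) simp
  show ?case
    using descent_Suc[of 0] descent_0 left_braid_two by (simp add: numeral_2_eq_2)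
next
  case (step m)
  interpret braid_images "Aut C (L (Suc (Suc m)))" "Suc (Suc m)" "S (Suc (Suc m))"
    by (rule braid_images_left) simp
  let ?J = "inv_arrow C (Assoc C X (L m) X)"
  \<comment> \<open>Its source and target are recorded as products with \<open>X\<close>, the shape
    needed to compose its whiskering with the last crossing.\<close>
  define D where "D = desc (Suc m) m"
  have D: "D \<in> Arr C" "Dom C D = L m \<boxtimes> X" "Cod C D = L m \<boxtimes> X"
    unfolding D_def left_power_Suc[OF step.hyps(1), symmetric] by simp_all
  have "Braid C X (L (Suc m)) = S (Suc (Suc m)) (Suc m) \<star> (Braid C X (L m) \<boxtimes>\<^sub>a Ident C X) \<star> ?J"
    using step.hyps by (simp add: left_power_Suc braid_before_last left_braid_last)
  also have "Braid C X (L m) \<boxtimes>\<^sub>a Ident C X = (D \<boxtimes>\<^sub>a Ident C X) \<star> (Mg 1 m \<boxtimes>\<^sub>a Ident C X)"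
    using step.hyps D by (simp add: left_power_Suc step.IH[folded D_def, unfolded One_nat_def])
  also have "S (Suc (Suc m)) (Suc m) \<star> ((D \<boxtimes>\<^sub>a Ident C X) \<star> (Mg 1 m \<boxtimes>\<^sub>a Ident C X)) \<star> ?J
      = (S (Suc (Suc m)) (Suc m) \<star> (D \<boxtimes>\<^sub>a Ident C X)) \<star> (Mg 1 m \<boxtimes>\<^sub>a Ident C X) \<star> ?J"
    using step.hyps D by (simp add: left_power_Suc del: tens_comp')
  also have "\<dots> = desc (Suc (Suc m)) (Suc m) \<star> Mg 1 (Suc m)"
    using step.hyps by (simp only: D_def descent_whisker lessI descent_Suc merge_Suc aut_mult left_power.simps(2) One_nat_def)
  finally show ?case .
qed

theorem left_full_twist:
  "m \<ge> 1 \<Longrightarrow> list_mult (Aut C (L m)) (map (left_twist m) [1..<m + 1]) \<star> (asc m (m - 1) [^]\<^bsub>Aut C (L m)\<^esub> m)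
    = Twist C (L m)"
proof (induction m rule: dec_induct)
  case base
  interpret braid_images "Aut C (L 1)" 1 "S 1" by (rule braid_images_left) simp
  interpret group "Aut C X" by (simp add: group_Aut)
  show ?case
    using ascent_0 by (simp add: list_mult_def)
next
  case (step m)
  interpret group_hom "Aut C (L m)" "Aut C (L (Suc m))" "\<lambda>s. s \<boxtimes>\<^sub>a Ident C X"
    using step by (intro group_hom_whisker) simp
  interpret B: braid_images "Aut C (L (Suc m))" "Suc m" "S (Suc m)"
    by (rule braid_images_left) simp
  define T where "T = list_mult (Aut C (L m)) (map (left_twist m) [1..<m + 1])"
  define A where "A = asc m (m - 1) [^]\<^bsub>Aut C (L m)\<^esub> m"
  let ?I = "Ident C X" and ?t = "Ident C (L m) \<boxtimes>\<^sub>a Twist C X"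
  let ?b = "Braid C X (L m) \<star> Braid C (L m) X"
  obtain p where p: "m = Suc p"
    using step by (cases m) auto
  have closed: "set (map (left_twist m) [1..<m + 1]) \<subseteq> carrier (Aut C (L m))"
    "asc m (m - 1) \<in> carrier (Aut C (L m))"
    using step by (auto intro!: left_twist_aut simp: aut_carrier)
  then have "T \<in> carrier (Aut C (L m))" "A \<in> carrier (Aut C (L m))"
    unfolding T_def A_def by (simp_all only: G.list_mult_closed G.nat_pow_closed)
  then have TA [simp]: "T \<in> Arr C" "Dom C T = L m" "Cod C T = L m" "A \<in> Arr C" "Dom C A = L m" "Cod C A = L m"
    by (auto simp: aut_carrier iso_arr)
  have "map (left_twist (Suc m)) [1..<m + 1] = map (\<lambda>s. s \<boxtimes>\<^sub>a ?I) (map (left_twist m) [1..<m + 1])"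
    using step by (auto simp: left_twist_Suc)
  then have "list_mult (Aut C (L (Suc m))) (map (left_twist (Suc m)) [1..<m + 1]) = T \<boxtimes>\<^sub>a ?I"
    unfolding T_def by (simp only: hom_list_mult[OF closed(1)])
  moreover have "map (left_twist (Suc m)) [1..<Suc m + 1] = map (left_twist (Suc m)) [1..<m + 1] @ [?t]"
    using step by (simp add: left_twist_Suc)
  moreover have "set (map (left_twist (Suc m)) [1..<m + 1]) \<subseteq> carrier (Aut C (L (Suc m)))"
    "?t \<in> carrier (Aut C (L (Suc m)))"
    using step by (auto intro!: left_twist_aut simp: aut_carrier left_power_Suc)
  ultimately have twists: "list_mult (Aut C (L (Suc m))) (map (left_twist (Suc m)) [1..<Suc m + 1]) = (T \<boxtimes>\<^sub>a ?I) \<star> ?t"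
    using H.list_mult_snoc by simp
  have "asc (Suc m) m [^]\<^bsub>Aut C (L (Suc m))\<^esub> Suc m
      = (asc (Suc m) p [^]\<^bsub>Aut C (L (Suc m))\<^esub> m) \<star> (desc (Suc m) m \<star> asc (Suc m) m)"
    using B.ascent_full_power[of p] p by (simp del: nat_pow_Suc)
  also have "asc (Suc m) p [^]\<^bsub>Aut C (L (Suc m))\<^esub> m = A \<boxtimes>\<^sub>a ?I"
    unfolding A_def hom_nat_pow[OF closed(2)] using p ascent_whisker[of p m] by simp
  \<comment> \<open>The bracketing arrow \<open>Mg 1 m\<close> ends the first braiding and starts
    the second, so the product of descent and ascent is the double braiding of the m-strand power
    with \<open>X\<close>.\<close>
  also have "desc (Suc m) m \<star> asc (Suc m) m = ?b"
    using step by (simp add: braid_descent_merge flip: merge_braid_ascent)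
  finally have braids: "asc (Suc m) (Suc m - 1) [^]\<^bsub>Aut C (L (Suc m))\<^esub> Suc m = (A \<boxtimes>\<^sub>a ?I) \<star> ?b"
    by simp
  have "T \<star> A = Twist C (L m)"
    using step.IH by (simp only: T_def A_def)
  \<comment> \<open>By interchange, the twist of the new strand passes the crossings of the first m
    strands, so the old full twist can be assembled there.\<close>
  then have "(T \<boxtimes>\<^sub>a ?I) \<star> ?t \<star> (A \<boxtimes>\<^sub>a ?I) = Twist C (L m) \<boxtimes>\<^sub>a Twist C X"
    by simp
  then have "((T \<boxtimes>\<^sub>a ?I) \<star> ?t) \<star> ((A \<boxtimes>\<^sub>a ?I) \<star> ?b) = (Twist C (L m) \<boxtimes>\<^sub>a Twist C X) \<star> ?b"
    using comp_reassoc[of "(T \<boxtimes>\<^sub>a ?I) \<star> ?t" "A \<boxtimes>\<^sub>a ?I" "Twist C (L m) \<boxtimes>\<^sub>a Twist C X" ?b] by simp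
  also have "\<dots> = Twist C (L (Suc m))"
    using step by (simp add: left_power_Suc twist_tens)
  finally show ?case
    by (simp only: twists braids)
qed

section \<open>Arbitrary parenthesizations\<close>

abbreviation XP where "XP \<equiv> power_obj C X"

abbreviation nest where "nest \<equiv> left_nest C X"

lemma strands_pos [simp]: "strands P \<ge> 1" "strands P \<ge> Suc 0"
  by (induction P) auto

lemma power_obj_closed [simp]: "XP P \<in> Obj C"
  by (induction P) simp_all

lemma nest_simps [simp]:
  "nest P \<in> Arr C" "Dom C (nest P) = XP P" "Cod C (nest P) = L (strands P)" "iso_arrow C (nest P)"
proof -
  have "nest P \<in> Arr C \<and> Dom C (nest P) = XP P \<and> Cod C (nest P) = L (strands P) \<and> iso_arrow C (nest P)"
    by (induction P) simp_all
  then show "nest P \<in> Arr C" "Dom C (nest P) = XP P" "Cod C (nest P) = L (strands P)" "iso_arrow C (nest P)"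
    by auto
qed

lemma strand_twist_aut: "strand_twist C X P i \<in> carrier (Aut C (XP P))"
  by (induction P arbitrary: i) (auto simp: aut_carrier iso_arr)

text \<open>The crossings are defined by transport along \<open>left_nest\<close>, but the strand
  twists are defined on the tree of brackets; that they agree with transport needs the numbering of
  strands under merging.\<close>

lemma nest_twist:
  "\<lbrakk>1 \<le> i; i \<le> strands P\<rbrakk> \<Longrightarrow> intertwines (nest P) (strand_twist C X P i) (left_twist (strands P) i)"
proof (induction P arbitrary: i)
  case Strand
  then show ?case by (simp add: intertwines_ident)
next
  case (Join P Q)
  have id: "intertwines (nest R) (Ident C (XP R)) (Ident C (L (strands R)))" for R
    by (rule intertwinesI) simp_all
  show ?case
  proof (cases "i \<le> strands P")
    case True
    then show ?thesis
      using intertwines_trans[OF intertwines_tens[OF Join.IH(1) id[of Q]] merge_twist_left] Join.prems by simp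
  next
    case False
    define j where "j = i - strands P"
    have j: "1 \<le> j" "j \<le> strands Q" "i = strands P + j"
      using False Join.prems by (auto simp: j_def)
    then show ?thesis
      using intertwines_trans[OF intertwines_tens[OF id[of P] Join.IH(2)] merge_twist_right, of j] by simp
  qed
qed

lemma nest_braid:
  "\<lbrakk>1 \<le> i; i < strands P\<rbrakk> \<Longrightarrow> intertwines (nest P) (strand_braid C X P i) (S (strands P) i)"
  by (rule intertwinesI) (simp_all add: strand_braid_def)

lemma strand_braid_aut:
  "\<lbrakk>1 \<le> i; i < strands P\<rbrakk> \<Longrightarrow> strand_braid C X P i \<in> carrier (Aut C (XP P))"
  by (simp add: aut_carrier strand_braid_def)

lemma group_hom_nest: "group_hom (Aut C (XP P)) (Aut C (L (strands P))) (conj_by (nest P))"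
  using conj_by_hom[of "nest P"] by (simp add: group_hom_def group_hom_axioms_def group_Aut)

lemma framed_braid_images_strands:
  "framed_braid_images (Aut C (XP P)) (strands P) (strand_braid C X P) (strand_twist C X P)"
proof (rule framed_braid_images_pullback[OF group_hom_nest])
  show "framed_braid_images (Aut C (L (strands P))) (strands P) (S (strands P)) (left_twist (strands P))"
    by (rule framed_braid_images_left) simp
  show "inj_on (conj_by (nest P)) (carrier (Aut C (XP P)))"
    using conj_by_inj[of "nest P"] by simp
qed (simp_all add: strand_braid_aut strand_twist_aut conj_by_intertwines[OF nest_braid]
    conj_by_intertwines[OF nest_twist])

text \<open>The defining formula is that of \<open>framed_rep\<close>, now available as a
  homomorphism since the relations have been verified.\<close>

lemma canonical_rep_eq:
  "canonical_rep C X P =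
    framed_braid_images.framed_rep (Aut C (XP P)) (strands P) (strand_braid C X P) (strand_twist C X P)"
  by (simp add: canonical_rep_def Let_def
      framed_braid_images.framed_rep_def[OF framed_braid_images_strands]
      framed_braid_images.lattice_rep_def[OF framed_braid_images_strands])

theorem canonical_rep_full_twist: "canonical_rep C X P (framed_full_twist (strands P)) = Twist C (XP P)"
proof -
  interpret R: framed_braid_images "Aut C (XP P)" "strands P" "strand_braid C X P" "strand_twist C X P"
    by (rule framed_braid_images_strands)
  interpret K: framed_braid_images "Aut C (L (strands P))" "strands P" "S (strands P)" "left_twist (strands P)"
    by (rule framed_braid_images_left) simp
  let ?h = "conj_by (nest P)"
  have mem: "R.framed_rep (framed_full_twist (strands P)) \<in> carrier (Aut C (XP P))"
    "Twist C (XP P) \<in> carrier (Aut C (XP P))"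
    using R.framed_rep_hom framed_full_twist_closed[OF strands_pos(1)] twist_aut[OF power_obj_closed]
    by (auto simp: hom_def)
  have "?h (R.framed_rep (framed_full_twist (strands P))) = K.framed_rep (framed_full_twist (strands P))"
    unfolding R.framed_rep_full_twist[OF strands_pos(1)] K.framed_rep_full_twist[OF strands_pos(1)]
    using group_hom_nest K.framed_braid_images_axioms R.framed_braid_images_axioms strands_pos(1)
    by (rule full_twist_image) (simp_all add: conj_by_intertwines[OF nest_braid] conj_by_intertwines[OF nest_twist])
  also have "\<dots> = Twist C (L (strands P))"
    using left_full_twist[OF strands_pos(1)] by (simp only: K.framed_rep_full_twist[OF strands_pos(1)] aut_mult)
  \<comment> \<open>Naturality of the twist at \<open>nest P\<close> means that conjugation by it
    carries the twist of one bracketing to that of the other.\<close>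
  also have "\<dots> = ?h (Twist C (XP P))"
  proof (rule conj_by_intertwines[symmetric], rule intertwinesI)
    show "nest P \<star> Twist C (XP P) = Twist C (L (strands P)) \<star> nest P"
      by (rule twist_natural[symmetric]) (simp add: Hom_def)
  qed simp_all
  finally have "R.framed_rep (framed_full_twist (strands P)) = Twist C (XP P)"
    using conj_by_inj[of "nest P"] mem by (auto simp: inj_on_def)
  then show ?thesis
    by (simp add: canonical_rep_eq)
qed

end

section \<open>Balanced contractions annihilate twists\<close>

context balanced_contraction
begin

text \<open>Sliding \<open>\<theta>\<^sub>X\<close> through the braiding exhibits \<open>\<theta>\<^bsub>Y\<otimes>X\<^esub>\<close> as a composite of two arrows that are
  contracted to identities; an arbitrary object is reached through its right unit constraint.\<close>

lemma contract_twist_tens: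
  assumes "X \<in> Obj C" "Y \<in> Obj C"
  shows "Fa (Twist C (Y \<boxtimes> X)) = Ident D (Fo (Y \<boxtimes> X))"
proof -
  have twist: "Twist C X \<in> Hom C X X" "Twist C Y \<in> Hom C Y Y"
    using twist_aut assms by (auto simp: aut_carrier Hom_def iso_arr)
  note [simp] = homD[OF twist(1)] homD[OF twist(2)]
  let ?f = "(Twist C Y \<boxtimes>\<^sub>a Ident C X) \<star> Braid C X Y" and ?g = "(Twist C X \<boxtimes>\<^sub>a Ident C Y) \<star> Braid C Y X"
  have "Braid C X Y \<star> (Twist C X \<boxtimes>\<^sub>a Ident C Y) = (Ident C Y \<boxtimes>\<^sub>a Twist C X) \<star> Braid C X Y"
    using assms twist by (intro braid_natural id_hom)
  then have "Braid C X Y \<star> ?g = ((Ident C Y \<boxtimes>\<^sub>a Twist C X) \<star> Braid C X Y) \<star> Braid C Y X"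
    using assms by (intro comp_reassoc) simp_all
  then have "?f \<star> ?g = (Twist C Y \<boxtimes>\<^sub>a Ident C X) \<star> (((Ident C Y \<boxtimes>\<^sub>a Twist C X) \<star> Braid C X Y) \<star> Braid C Y X)"
    using assms by simp
  also have "\<dots> = ((Twist C Y \<boxtimes>\<^sub>a Ident C X) \<star> (Ident C Y \<boxtimes>\<^sub>a Twist C X)) \<star> (Braid C X Y \<star> Braid C Y X)"
    using assms by (simp del: tens_comp')
  also have "\<dots> = Twist C (Y \<boxtimes> X)"
    using assms by (simp add: twist_tens)
  finally have "Fa (Twist C (Y \<boxtimes> X)) = Fa (?f \<star> ?g)"
    by (simp only:)
  also have "\<dots> = Fa ?f \<star>\<^bsub>D\<^esub> Fa ?g"
    by (rule functor_comp') (use assms in simp_all)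
  \<comment> \<open>The factors contract to identities of the two orders of the product;
    \<open>contract_swap\<close> makes these the same object.\<close>
  finally show ?thesis
    using assms by (simp add: contract_braid contract_swap functor_obj)
qed

lemma contract_twist:
  assumes "X \<in> Obj C"
  shows "Fa (Twist C X) = Ident D (Fo X)"
proof -
  let ?r = "RUnit C X" and ?\<theta> = "Twist C (X \<boxtimes> Unit C)"
  have twist: "Twist C X \<in> Arr C" "Dom C (Twist C X) = X" "Cod C (Twist C X) = X"
      "?\<theta> \<in> Arr C" "Dom C ?\<theta> = X \<boxtimes> Unit C" "Cod C ?\<theta> = X \<boxtimes> Unit C"
    using twist_aut[of X] twist_aut[of "X \<boxtimes> Unit C"] assms by (auto simp: aut_carrier iso_arr)
  have r: "?r \<in> Arr C" "Dom C ?r = X \<boxtimes> Unit C" "Cod C ?r = X" "iso_arrow C ?r"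
    using runit_hom[OF assms] runit_iso[OF assms] by (auto simp: Hom_def)
  have "Twist C X \<star> ?r = ?r \<star> ?\<theta>"
    using twist_natural[OF runit_hom[OF assms]] .
  then have "Fa (Twist C X) \<star>\<^bsub>D\<^esub> Fa ?r = Fa ?r \<star>\<^bsub>D\<^esub> Fa ?\<theta>"
    using twist r by (simp flip: functor_comp')
  also have "\<dots> = Fa ?r"
    using assms r contract_twist_tens[of "Unit C" X] by simp
  \<comment> \<open>The image of the unit constraint is still invertible, so it can be cancelled on
    the right.\<close>
  finally have "(Fa (Twist C X) \<star>\<^bsub>D\<^esub> Fa ?r) \<star>\<^bsub>D\<^esub> inv_arrow D (Fa ?r) = Fa ?r \<star>\<^bsub>D\<^esub> inv_arrow D (Fa ?r)"
    by simp
  then show ?thesis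
    using twist r by simp
qed

end

section \<open>Assembling the diagram\<close>

theorem proposition16:
  fixes C :: "('o, 'm) balanced_cat" and D :: "('p, 'n) cat"
    and Fo :: "'o \<Rightarrow> 'p" and Fa :: "'m \<Rightarrow> 'n"
    and X :: 'o and n :: nat and P :: paren
  defines "B \<equiv> braid_group n" and "Z \<equiv> full_twist_subgroup n"
    and "BF \<equiv> framed_braid_group n" and "ZF \<equiv> framed_full_twist_subgroup n"
    and "XP \<equiv> power_obj C X P" and "\<rho> \<equiv> canonical_rep C X P"
  assumes "balanced_category C" and "category D" and "balanced_contraction C D Fo Fa"
    and "X \<in> Obj C" and "n \<ge> 1" and "strands P = n"
  shows
    "group B \<and> group (B Mod Z) \<and> group BF \<and> group (BF Mod ZF) \<and>
     group (Aut C XP) \<and> group (Aut D (Fo XP)) \<and>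
     \<comment> \<open>top row\<close>
     snd \<in> hom BF B \<and> (\<forall>i\<in>{1..n}. snd (framing_gen n i) = \<one>\<^bsub>B\<^esub>) \<and>
     \<rho> \<in> hom BF (Aut C XP) \<and>
     (\<forall>i\<in>{1..n}. \<rho> (framing_gen n i) = strand_twist C X P i) \<and>
     (\<forall>i\<in>{1..<n}. \<rho> (framed_braid n (braid_gen n i)) = strand_braid C X P i) \<and>
     \<comment> \<open>columns\<close>
     (\<lambda>b. Z #>\<^bsub>B\<^esub> b) \<in> hom B (B Mod Z) \<and>
     (\<lambda>g. ZF #>\<^bsub>BF\<^esub> g) \<in> hom BF (BF Mod ZF) \<and>
     Fa \<in> hom (Aut C XP) (Aut D (Fo XP)) \<and>
     \<comment> \<open>bottom row and commutativity\<close>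
     (\<lambda>K. snd ` K) \<in> hom (BF Mod ZF) (B Mod Z) \<and>
     (\<forall>g\<in>carrier BF. snd ` (ZF #>\<^bsub>BF\<^esub> g) = Z #>\<^bsub>B\<^esub> snd g) \<and>
     (\<exists>r \<in> hom (BF Mod ZF) (Aut D (Fo XP)).
        \<forall>g\<in>carrier BF. r (ZF #>\<^bsub>BF\<^esub> g) = Fa (\<rho> g))"
proof -
  interpret balanced_contraction C D Fo Fa by (rule assms(9))
  interpret power_of_object C X by (unfold_locales) (rule assms(10))
  have n: "n \<ge> 1" and P: "strands P = n"
    by (fact assms)+
  interpret R: framed_braid_images "Aut C XP" n "strand_braid C X P" "strand_twist C X P"
    using framed_braid_images_strands[of P] by (simp only: P XP_def)
  have rep: "\<rho> = R.framed_rep"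
    using canonical_rep_eq[of P] by (simp only: \<rho>_def P XP_def)
  have XP: "XP \<in> Obj C"
    by (simp add: XP_def)
  interpret BF: group_hom BF B snd
    using group_framed_braid_group group_braid_group snd_hom
    by (simp add: BF_def B_def group_hom_def group_hom_axioms_def)
  interpret Z: normal Z B
    unfolding Z_def B_def using n by (rule normal_full_twist_subgroup)
  interpret ZF: normal ZF BF
    unfolding ZF_def BF_def using n by (rule normal_framed_full_twist_subgroup)
  have image: "snd ` ZF = Z"
    unfolding ZF_def Z_def using n by (rule snd_framed_full_twist_subgroup)
  have A: "group (Aut D (Fo XP))"
    using XP by (simp add: target.group_Aut functor_obj)
  have rho_hom: "\<rho> \<in> hom BF (Aut C XP)"
    unfolding rep BF_def by (rule R.framed_rep_hom)
  have h_hom: "(\<lambda>g. Fa (\<rho> g)) \<in> hom BF (Aut D (Fo XP))"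
    using Group.hom_compose[OF rho_hom functor_aut_hom] by (simp add: comp_def)
  interpret h: group_hom BF "Aut D (Fo XP)" "\<lambda>g. Fa (\<rho> g)"
    using h_hom A BF.G.is_group by (simp add: group_hom_def group_hom_axioms_def)
  have "Fa (\<rho> (framed_full_twist n)) = \<one>\<^bsub>Aut D (Fo XP)\<^esub>"
    using canonical_rep_full_twist[of P] contract_twist[OF XP] by (simp add: \<rho>_def P XP_def)
  \<comment> \<open>A kernel is a subgroup, so it contains \<open>ZF\<close> as soon as it contains
    the generator.\<close>
  then have "ZF \<subseteq> kernel BF (Aut D (Fo XP)) (\<lambda>g. Fa (\<rho> g))"
    unfolding ZF_def framed_full_twist_subgroup_eq[OF n] BF_def[symmetric]
    using framed_full_twist_closed[OF n] h.subgroup_kernel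
    by (intro BF.G.generate_subgroup_incl) (auto simp: kernel_def BF_def)
  then have "\<exists>r \<in> hom (BF Mod ZF) (Aut D (Fo XP)). \<forall>g\<in>carrier BF. r (ZF #>\<^bsub>BF\<^esub> g) = Fa (\<rho> g)"
    by (intro ZF.factor_lift A h_hom) (auto simp: kernel_def)
  moreover have "snd (framing_gen n i) = \<one>\<^bsub>B\<^esub>" for i
    by (simp add: framing_gen_def B_def)
  moreover have "\<rho> (framing_gen n i) = strand_twist C X P i" if "i \<in> {1..n}" for i
    unfolding rep using that by (rule R.framed_rep_framing_gen)
  moreover have "\<rho> (framed_braid n (braid_gen n i)) = strand_braid C X P i" if "i \<in> {1..<n}" for i
    unfolding rep using that by (rule R.framed_rep_braid_gen)
  moreover have "(\<lambda>K. snd ` K) \<in> hom (BF Mod ZF) (B Mod Z)"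
    "\<forall>g\<in>carrier BF. snd ` (ZF #>\<^bsub>BF\<^esub> g) = Z #>\<^bsub>B\<^esub> snd g"
    using BF.image_FactGroup[OF ZF.normal_axioms Z.normal_axioms image] by blast+
  ultimately show ?thesis
    using BF.G.is_group BF.H.is_group Z.factorgroup_is_group ZF.factorgroup_is_group
      group_Aut[OF XP] A BF.homh rho_hom Z.r_coset_hom_Mod ZF.r_coset_hom_Mod functor_aut_hom
    by blast
qed

end
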